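(* Let $f=(f^1,\dots,f^n)$, $S=(S^1,\dots,S^n)$ and $\xi=(\xi^1,\dots,\xi^n)$ satisfy assumptions $(\mathscr{A}1)$–$(\mathscr{A}4)$ (spelled out in the context). Let $(Y,Z,K)$, with $(Y,Z\cdot W,K)\in\mathcal{S}^{\infty}(\mathbb{R}^n)\times BMO\times\mathcal{S}^p(\mathbb{R}^n)$ for any $p\ge2$, be a solution of the reflected BSDE: for $i=1,\dots,n$ and $t\in[0,T]$, $$Y_t^i=\xi^i+\int_t^T f^i(s,Y_s,Z_s^i)\,ds+K_T^i-K_t^i-\int_t^T Z_s^i\,dW_s,\qquad Y_t^i\ge S_t^i,\qquad \int_0^T (Y_t^i-S_t^i)\,dK_t^i=0,$$ where $K$ is an $n$-dimensional continuous (componentwise) nondecreasing process with $K_0=0$. Then for all $t\in[0,T]$ and $i=1,\dots,n$, $$Y_t^i=\operatorname*{ess\,sup}_{\nu\in\mathcal{T}_t}E_t\Big[\int_t^\nu f^i(s,Y_s,Z_s^i)\,ds+S_\nu^i 1_{\{\nu<T\}}+\xi^i1_{\{\nu=T\}}\Big],$$ where $E_t[\cdot]=E[\cdot\,|\,\mathcal{F}_t]$, $\mathcal{T}$ is the set of all stopping times dominated by $T$, and $\mathcal{T}_t=\{\nu\in\mathcal{T}:\ t\le\nu\le T\}$.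
   Context: Setting. $T>0$ is a finite time, $n,d\ge1$ are integers, $W$ is a $d$-dimensional standard Brownian motion on a probability space $(\Omega,\mathcal{F},P)$, and $(\mathcal{F}_t)_{0\le t\le T}$ is its augmented natural filtration. Equalities and inequalities between random variables (resp. processes) are understood $P$-a.s. (resp. $P\otimes dt$-a.e.). $|\cdot|$ is the Euclidean norm, $\|\eta\|_\infty=\operatorname{ess\,sup}_\omega|\eta(\omega)|$, and $x\le y$ in $\mathbb{R}^n$ is componentwise. Unknowns: $Y$ is an adapted continuous $\mathbb{R}^n$-valued process, $Z$ is a predictable $\mathbb{R}^{n\times d}$-valued process with rows $Z^i$, and $K$ is an adapted $\mathbb{R}^n$-valued process. Spaces. For $p\ge2$, $\mathcal{S}^p(\mathbb{R}^n)$ is the space of $n$-dimensional predictable processes $Y$ on $[0,T]$ with $E\big[(\sup_{0\le t\le T}|Y_t|^2)^{p/2}\big]^{1/p}<\infty$. $\mathcal{S}^\infty(\mathbb{R}^n)$ is the space of $n$-dimensional predictable processes $Y$ with $\|Y\|_{\mathcal{S}^\infty(\mathbb{R}^n)}:=\|\sup_{0\le t\le T}|Y_t|\|_\infty<\infty$. $L^\infty(\mathbb{R}^n)$ is the space of $\mathcal{F}_T$-measurable $\mathbb{R}^n$-valued $\xi$ with $\|\xi\|_{L^\infty(\mathbb{R}^n)}:=\|\xi\|_\infty<\infty$. $BMO$ is the class of uniformly integrable martingales $M$ with $M_0=0$ and $\sup_{\tau}\big\|E[|M_T-M_\tau|^2\,|\,\mathcal{F}_\tau]^{1/2}\big\|_\infty<\infty$,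 the supremum being over all stopping times $\tau$ with values in $[0,T]$. $(Z\cdot W)_t:=\int_0^t Z_s\,dW_s$. Assumptions, for some constant $C>0$: $(\mathscr{A}1)$ For $i=1,\dots,n$, $f^i:\Omega\times[0,T]\times\mathbb{R}^n\times\mathbb{R}^d\to\mathbb{R}$ is such that $f^i(\cdot,y,z^i)$ is adapted (and jointly measurable in $(\omega,t)$) for each $y\in\mathbb{R}^n$, $z^i\in\mathbb{R}^d$, and for all $y,\bar y\in\mathbb{R}^n$, $z^i,\bar z^i\in\mathbb{R}^d$: $|f^i(t,y,z^i)|\le C(1+|y|+|z^i|^2)$ and $|f^i(t,y,z^i)-f^i(t,\bar y,\bar z^i)|\le C|y-\bar y|+C(1+|z^i|+|\bar z^i|)|z^i-\bar z^i|$. $(\mathscr{A}2)$ For $t\in[0,T]$, $i=1,\dots,n$ and $z^i\in\mathbb{R}^d$, $f^i(t,y,z^i)\le f^i(t,\bar y,z^i)$ for any $y,\bar y\in\mathbb{R}^n$ with $y^i=\bar y^i$ and $y^j\le\bar y^j$ for $j\ne i$. $(\mathscr{A}3)$ $S$ is a continuous progressively measurable $\mathbb{R}^n$-valued process with $\|S^+\|_{\mathcal{S}^\infty(\mathbb{R}^n)}\le C$, where $S^+$ is the componentwise positive part. $(\mathscr{A}4)$ $\xi$ is $\mathcal{F}_T$-measurable, $\mathbb{R}^n$-valued, with $\|\xi\|_{L^\infty(\mathbb{R}^n)}\le C$. *)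

theory Defs
  imports "HOL-Probability.Probability"
begin

text \<open>
  A process on the time interval from 0 to T is a function of time and scenario; only its values at
  times in \<open>{0..T}\<close> matter. Pathwise properties (continuity, monotonicity) are required
  almost surely.
\<close>

section \<open>Brownian motion and its augmented filtration\<close>

definition natural_filtration ::
  "'a measure \<Rightarrow> (real \<Rightarrow> 'a \<Rightarrow> 'b::topological_space) \<Rightarrow> real \<Rightarrow> 'a measure" where
  "natural_filtration M W t =
     sigma (space M) (\<Union>s\<in>{0..t}. {W s -` B \<inter> space M | B. B \<in> sets borel})"

definition brownian_motion ::
  "'a measure \<Rightarrow> real \<Rightarrow> (real \<Rightarrow> 'a \<Rightarrow> real ^ 'd) \<Rightarrow> bool" where
  "brownian_motion M T W \<longleftrightarrow>
     prob_space M \<and>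
     (\<forall>t\<in>{0..T}. W t \<in> borel_measurable M) \<and>
     (AE \<omega> in M. W 0 \<omega> = 0) \<and>
     (AE \<omega> in M. continuous_on {0..T} (\<lambda>t. W t \<omega>)) \<and>
     (\<forall>s t. 0 \<le> s \<and> s < t \<and> t \<le> T \<longrightarrow>
        prob_space.indep_set M (sets (natural_filtration M W s))
          {(\<lambda>\<omega>. W t \<omega> - W s \<omega>) -` B \<inter> space M | B. B \<in> sets borel} \<and>
        prob_space.indep_vars M (\<lambda>_. borel) (\<lambda>k \<omega>. (W t \<omega> - W s \<omega>) $ k) UNIV \<and>
        (\<forall>k. distributed M lborel (\<lambda>\<omega>. (W t \<omega> - W s \<omega>) $ k) (normal_density 0 (sqrt (t - s)))))"

text \<open>
  The null sets added are all subsets of measurable null sets, so the augmented filtration consists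
  of sub-sigma-algebras of \<open>completion M\<close>. Times beyond the horizon are identified with \<open>T\<close>.
\<close>

definition augmented_filtration ::
  "'a measure \<Rightarrow> real \<Rightarrow> (real \<Rightarrow> 'a \<Rightarrow> 'b::topological_space) \<Rightarrow> real \<Rightarrow> 'a measure" where
  "augmented_filtration M T W t =
     sigma (space M) (sets (natural_filtration M W (min t T)) \<union> null_sets (completion M))"

section \<open>Measurability of processes and stopping times\<close>

definition adapted ::
  "(real \<Rightarrow> 'a measure) \<Rightarrow> real \<Rightarrow> (real \<Rightarrow> 'a \<Rightarrow> 'b::topological_space) \<Rightarrow> bool" where
  "adapted F T X \<longleftrightarrow> (\<forall>t\<in>{0..T}. X t \<in> borel_measurable (F t))"

definition progressively_measurable ::
  "(real \<Rightarrow> 'a measure) \<Rightarrow> real \<Rightarrow> (real \<Rightarrow> 'a \<Rightarrow> 'b::topological_space) \<Rightarrow> bool" where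
  "progressively_measurable F T X \<longleftrightarrow>
     (\<forall>t\<in>{0..T}. (\<lambda>(\<omega>, s). X s \<omega>) \<in> borel_measurable (F t \<Otimes>\<^sub>M restrict_space borel {0..t}))"

definition predictable_sigma :: "(real \<Rightarrow> 'a measure) \<Rightarrow> real \<Rightarrow> ('a \<times> real) measure" where
  "predictable_sigma F T =
     sigma (space (F 0) \<times> {0..T})
       ({A \<times> {0} | A. A \<in> sets (F 0)} \<union>
        {A \<times> {s<..t} | A s t. 0 \<le> s \<and> s \<le> t \<and> t \<le> T \<and> A \<in> sets (F s)})"

definition predictable ::
  "(real \<Rightarrow> 'a measure) \<Rightarrow> real \<Rightarrow> (real \<Rightarrow> 'a \<Rightarrow> 'b::topological_space) \<Rightarrow> bool" where
  "predictable F T X \<longleftrightarrow> (\<lambda>(\<omega>, t). X t \<omega>) \<in> borel_measurable (predictable_sigma F T)"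

definition continuous_process ::
  "'a measure \<Rightarrow> real \<Rightarrow> (real \<Rightarrow> 'a \<Rightarrow> 'b::topological_space) \<Rightarrow> bool" where
  "continuous_process P T X \<longleftrightarrow> (AE \<omega> in P. continuous_on {0..T} (\<lambda>t. X t \<omega>))"

definition stopping_times_between ::
  "'a measure \<Rightarrow> (real \<Rightarrow> 'a measure) \<Rightarrow> real \<Rightarrow> real \<Rightarrow> ('a \<Rightarrow> real) set" where
  "stopping_times_between P F t T =
     {\<nu>. stopping_time F \<nu> \<and> (\<forall>\<omega>\<in>space P. t \<le> \<nu> \<omega> \<and> \<nu> \<omega> \<le> T)}"

section \<open>Spaces\<close>

definition ennreal_powr :: "ennreal \<Rightarrow> real \<Rightarrow> ennreal" where
  "ennreal_powr x a = (if x = top then top else ennreal (enn2real x powr a))"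
    \<comment> \<open>only used with positive exponents\<close>

definition Linf_norm :: "'a measure \<Rightarrow> ('a \<Rightarrow> 'b::real_normed_vector) \<Rightarrow> ennreal" where
  "Linf_norm P \<eta> = esssup P (\<lambda>\<omega>. ennreal (norm (\<eta> \<omega>)))"

definition Sinf_norm ::
  "'a measure \<Rightarrow> real \<Rightarrow> (real \<Rightarrow> 'a \<Rightarrow> 'b::real_normed_vector) \<Rightarrow> ennreal" where
  "Sinf_norm P T X = esssup P (\<lambda>\<omega>. SUP t\<in>{0..T}. ennreal (norm (X t \<omega>)))"

definition Sp_norm ::
  "'a measure \<Rightarrow> real \<Rightarrow> real \<Rightarrow> (real \<Rightarrow> 'a \<Rightarrow> 'b::real_normed_vector) \<Rightarrow> ennreal" where
  "Sp_norm P T p X =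
     ennreal_powr
       (\<integral>\<^sup>+\<omega>. ennreal_powr (SUP t\<in>{0..T}. ennreal ((norm (X t \<omega>))\<^sup>2)) (p / 2) \<partial>P) (1 / p)"

definition Sinf_space ::
  "'a measure \<Rightarrow> (real \<Rightarrow> 'a measure) \<Rightarrow> real \<Rightarrow> (real \<Rightarrow> 'a \<Rightarrow> 'b::real_normed_vector) set" where
  "Sinf_space P F T = {X. predictable F T X \<and> Sinf_norm P T X < \<infinity>}"

definition Sp_space ::
  "'a measure \<Rightarrow> (real \<Rightarrow> 'a measure) \<Rightarrow> real \<Rightarrow> real \<Rightarrow>
     (real \<Rightarrow> 'a \<Rightarrow> 'b::real_normed_vector) set" where
  "Sp_space P F T p = {X. predictable F T X \<and> Sp_norm P T p X < \<infinity>}"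

definition martingale ::
  "'a measure \<Rightarrow> (real \<Rightarrow> 'a measure) \<Rightarrow> real \<Rightarrow> (real \<Rightarrow> 'a \<Rightarrow> real ^ 'n) \<Rightarrow> bool" where
  "martingale P F T X \<longleftrightarrow>
     adapted F T X \<and> (\<forall>t\<in>{0..T}. integrable P (X t)) \<and>
     (\<forall>s t i. 0 \<le> s \<and> s \<le> t \<and> t \<le> T \<longrightarrow>
        (AE \<omega> in P. X s \<omega> $ i = real_cond_exp P (F s) (\<lambda>\<omega>. X t \<omega> $ i) \<omega>))"

definition uniformly_integrable ::
  "'a measure \<Rightarrow> real \<Rightarrow> (real \<Rightarrow> 'a \<Rightarrow> 'b::real_normed_vector) \<Rightarrow> bool" where
  "uniformly_integrable P T X \<longleftrightarrow>
     (\<forall>\<epsilon>>0. \<exists>c. \<forall>t\<in>{0..T}.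
        (\<integral>\<^sup>+\<omega>. ennreal (norm (X t \<omega>)) * indicator {\<omega>. norm (X t \<omega>) > c} \<omega> \<partial>P) \<le> ennreal \<epsilon>)"

definition BMO_norm ::
  "'a measure \<Rightarrow> (real \<Rightarrow> 'a measure) \<Rightarrow> real \<Rightarrow> (real \<Rightarrow> 'a \<Rightarrow> 'b::real_normed_vector) \<Rightarrow> ennreal"
  where
  "BMO_norm P F T X =
     (SUP \<tau>\<in>stopping_times_between P F 0 T.
        esssup P (\<lambda>\<omega>. ennreal_powr
          (nn_cond_exp P (filtration.pre_sigma (space P) F \<tau>)
             (\<lambda>\<omega>. ennreal ((norm (X T \<omega> - X (\<tau> \<omega>) \<omega>))\<^sup>2)) \<omega>) (1 / 2)))"

definition BMO ::
  "'a measure \<Rightarrow> (real \<Rightarrow> 'a measure) \<Rightarrow> real \<Rightarrow> (real \<Rightarrow> 'a \<Rightarrow> real ^ 'n) set" where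
  "BMO P F T =
     {X. martingale P F T X \<and> uniformly_integrable P T X \<and> (AE \<omega> in P. X 0 \<omega> = 0) \<and>
         BMO_norm P F T X < \<infinity>}"

section \<open>The Ito integral\<close>

text \<open>
  A simple integrand is given by its number \<open>m\<close> of steps, the grid \<open>\<tau>\<close> and the values \<open>h\<close>; it
  equals \<open>h j\<close> on the time interval from \<open>\<tau> j\<close> (exclusive) to \<open>\<tau> (Suc j)\<close> (inclusive).
\<close>

definition simple_integrand ::
  "'a measure \<Rightarrow> (real \<Rightarrow> 'a measure) \<Rightarrow> real \<Rightarrow> nat \<Rightarrow> (nat \<Rightarrow> real) \<Rightarrow>
     (nat \<Rightarrow> 'a \<Rightarrow> real ^ 'd) \<Rightarrow> bool" where
  "simple_integrand P F T m \<tau> h \<longleftrightarrow>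
     0 \<le> \<tau> 0 \<and> (\<forall>j<m. \<tau> j \<le> \<tau> (Suc j)) \<and> \<tau> m \<le> T \<and>
     (\<forall>j<m. h j \<in> borel_measurable (F (\<tau> j)) \<and> (\<exists>c. \<forall>\<omega>\<in>space P. norm (h j \<omega>) \<le> c))"

definition simple_process ::
  "nat \<Rightarrow> (nat \<Rightarrow> real) \<Rightarrow> (nat \<Rightarrow> 'a \<Rightarrow> real ^ 'd) \<Rightarrow> real \<Rightarrow> 'a \<Rightarrow> real ^ 'd" where
  "simple_process m \<tau> h t \<omega> = (\<Sum>j<m. indicator {\<tau> j<..\<tau> (Suc j)} t *\<^sub>R h j \<omega>)"

definition simple_integral ::
  "(real \<Rightarrow> 'a \<Rightarrow> real ^ 'd) \<Rightarrow> nat \<Rightarrow> (nat \<Rightarrow> real) \<Rightarrow> (nat \<Rightarrow> 'a \<Rightarrow> real ^ 'd) \<Rightarrow>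
     real \<Rightarrow> 'a \<Rightarrow> real" where
  "simple_integral W m \<tau> h t \<omega> =
     (\<Sum>j<m. h j \<omega> \<bullet> (W (min t (\<tau> (Suc j))) \<omega> - W (min t (\<tau> j)) \<omega>))"

definition to_zero_in_prob :: "'a measure \<Rightarrow> (nat \<Rightarrow> 'a \<Rightarrow> ennreal) \<Rightarrow> bool" where
  "to_zero_in_prob P X \<longleftrightarrow>
     (\<forall>\<epsilon>>0. (\<lambda>k. measure P {\<omega>\<in>space P. X k \<omega> > ennreal \<epsilon>}) \<longlonglongrightarrow> 0)"

text \<open>
  \<open>is_ito_integral P F T W H I\<close>: the real-valued process \<open>I\<close> is a version of the integral of the
  \<open>\<real>\<^sup>d\<close>-valued predictable process \<open>H\<close> against \<open>W\<close>, that is, the limit, uniformly on \<open>{0..T}\<close> in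
  probability, of the integrals of simple integrands approximating \<open>H\<close>. Such \<open>I\<close> is unique up to
  indistinguishability, and exists iff the time integral of \<open>\<bar>H\<bar>\<^sup>2\<close> is almost surely finite.
\<close>

definition is_ito_integral ::
  "'a measure \<Rightarrow> (real \<Rightarrow> 'a measure) \<Rightarrow> real \<Rightarrow> (real \<Rightarrow> 'a \<Rightarrow> real ^ 'd) \<Rightarrow>
     (real \<Rightarrow> 'a \<Rightarrow> real ^ 'd) \<Rightarrow> (real \<Rightarrow> 'a \<Rightarrow> real) \<Rightarrow> bool" where
  "is_ito_integral P F T W H I \<longleftrightarrow>
     predictable F T H \<and> adapted F T I \<and> continuous_process P T I \<and>
     (\<exists>m \<tau> h.
        (\<forall>k. simple_integrand P F T (m k) (\<tau> k) (h k)) \<and>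
        to_zero_in_prob P (\<lambda>k \<omega>.
          \<integral>\<^sup>+t\<in>{0..T}. ennreal ((norm (simple_process (m k) (\<tau> k) (h k) t \<omega> - H t \<omega>))\<^sup>2) \<partial>lborel) \<and>
        to_zero_in_prob P (\<lambda>k \<omega>.
          SUP t\<in>{0..T}. ennreal \<bar>simple_integral W (m k) (\<tau> k) (h k) t \<omega> - I t \<omega>\<bar>))"

section \<open>Conditional expectation and essential supremum of a family\<close>

text \<open>
  The obstacle is not bounded below, so the conditional expectations in the representation formula
  may take the value \<open>-\<infinity>\<close>; the library's \<open>real_cond_exp\<close> is meaningful for integrable
  random variables only.
\<close>

definition ereal_cond_exp :: "'a measure \<Rightarrow> 'a measure \<Rightarrow> ('a \<Rightarrow> real) \<Rightarrow> 'a \<Rightarrow> ereal" where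
  "ereal_cond_exp P G X =
     (\<lambda>\<omega>. enn2ereal (nn_cond_exp P G (\<lambda>\<omega>. ennreal (X \<omega>)) \<omega>)
         - enn2ereal (nn_cond_exp P G (\<lambda>\<omega>. ennreal (- X \<omega>)) \<omega>))"

definition is_esssup_family :: "'a measure \<Rightarrow> ('a \<Rightarrow> ereal) set \<Rightarrow> ('a \<Rightarrow> ereal) \<Rightarrow> bool" where
  "is_esssup_family P \<Phi> X \<longleftrightarrow>
     X \<in> borel_measurable P \<and>
     (\<forall>\<phi>\<in>\<Phi>. AE \<omega> in P. \<phi> \<omega> \<le> X \<omega>) \<and>
     (\<forall>X'\<in>borel_measurable P. (\<forall>\<phi>\<in>\<Phi>. AE \<omega> in P. \<phi> \<omega> \<le> X' \<omega>) \<longrightarrow> (AE \<omega> in P. X \<omega> \<le> X' \<omega>))"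

section \<open>Assumptions on the data\<close>

abbreviation time_measure :: "real \<Rightarrow> real measure" where
  "time_measure T \<equiv> restrict_space lborel {0..T}"

text \<open>
  The exceptional set in the inequalities on the generator does not depend on the space variables.
\<close>

definition assumption_A1 ::
  "'a measure \<Rightarrow> (real \<Rightarrow> 'a measure) \<Rightarrow> real \<Rightarrow> real \<Rightarrow>
     ('n \<Rightarrow> 'a \<Rightarrow> real \<Rightarrow> real ^ 'n \<Rightarrow> real ^ 'd \<Rightarrow> real) \<Rightarrow> bool" where
  "assumption_A1 P F T C f \<longleftrightarrow>
     (\<forall>i y z.
        adapted F T (\<lambda>t \<omega>. f i \<omega> t y z) \<and>
        (\<lambda>(\<omega>, t). f i \<omega> t y z) \<in> borel_measurable (P \<Otimes>\<^sub>M time_measure T)) \<and>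
     (\<forall>i. AE (\<omega>, t) in P \<Otimes>\<^sub>M time_measure T.
        (\<forall>y z. \<bar>f i \<omega> t y z\<bar> \<le> C * (1 + norm y + (norm z)\<^sup>2)) \<and>
        (\<forall>y y' z z'. \<bar>f i \<omega> t y z - f i \<omega> t y' z'\<bar>
           \<le> C * norm (y - y') + C * (1 + norm z + norm z') * norm (z - z')))"

definition assumption_A2 ::
  "'a measure \<Rightarrow> real \<Rightarrow> ('n \<Rightarrow> 'a \<Rightarrow> real \<Rightarrow> real ^ 'n \<Rightarrow> real ^ 'd \<Rightarrow> real) \<Rightarrow> bool" where
  "assumption_A2 P T f \<longleftrightarrow>
     (\<forall>i. AE (\<omega>, t) in P \<Otimes>\<^sub>M time_measure T.
        \<forall>y y' z. y $ i = y' $ i \<and> (\<forall>j. j \<noteq> i \<longrightarrow> y $ j \<le> y' $ j) \<longrightarrow> f i \<omega> t y z \<le> f i \<omega> t y' z)"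

definition assumption_A3 ::
  "'a measure \<Rightarrow> (real \<Rightarrow> 'a measure) \<Rightarrow> real \<Rightarrow> real \<Rightarrow> (real \<Rightarrow> 'a \<Rightarrow> real ^ 'n) \<Rightarrow> bool" where
  "assumption_A3 P F T C S \<longleftrightarrow>
     continuous_process P T S \<and> progressively_measurable F T S \<and>
     Sinf_norm P T (\<lambda>t \<omega>. \<chi> i. max 0 (S t \<omega> $ i)) \<le> ennreal C"

definition assumption_A4 ::
  "'a measure \<Rightarrow> (real \<Rightarrow> 'a measure) \<Rightarrow> real \<Rightarrow> real \<Rightarrow> ('a \<Rightarrow> real ^ 'n) \<Rightarrow> bool" where
  "assumption_A4 P F T C \<xi> \<longleftrightarrow> \<xi> \<in> borel_measurable (F T) \<and> Linf_norm P \<xi> \<le> ennreal C"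

section \<open>The reflected BSDE\<close>

text \<open>
  The Stieltjes measure of a path on \<open>{0..T}\<close>; the path is extended constantly outside that
  interval.
\<close>

definition stieltjes_measure :: "real \<Rightarrow> (real \<Rightarrow> real) \<Rightarrow> real measure" where
  "stieltjes_measure T k = interval_measure (\<lambda>s. k (max 0 (min s T)))"

text \<open>
  \<open>ZW\<close> is the stochastic integral process of \<open>Z\<close> against \<open>W\<close>, row by row. Time integrals of the
  generator are taken with respect to \<open>lebesgue\<close> rather than \<open>lborel\<close>: the generator is regular
  in the space variables only almost everywhere, so \<open>\<lambda>s. f i \<omega> s (Y s \<omega>) (Z s \<omega> $ i)\<close> is in general
  only Lebesgue measurable.
\<close>

definition reflected_bsde_solution ::
  "'a measure \<Rightarrow> (real \<Rightarrow> 'a measure) \<Rightarrow> real \<Rightarrow> (real \<Rightarrow> 'a \<Rightarrow> real ^ 'd) \<Rightarrow>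
     ('n \<Rightarrow> 'a \<Rightarrow> real \<Rightarrow> real ^ 'n \<Rightarrow> real ^ 'd \<Rightarrow> real) \<Rightarrow> ('a \<Rightarrow> real ^ 'n) \<Rightarrow>
     (real \<Rightarrow> 'a \<Rightarrow> real ^ 'n) \<Rightarrow>
     (real \<Rightarrow> 'a \<Rightarrow> real ^ 'n) \<Rightarrow> (real \<Rightarrow> 'a \<Rightarrow> real ^ 'd ^ 'n) \<Rightarrow> (real \<Rightarrow> 'a \<Rightarrow> real ^ 'n) \<Rightarrow>
     (real \<Rightarrow> 'a \<Rightarrow> real ^ 'n) \<Rightarrow> bool" where
  "reflected_bsde_solution P F T W f \<xi> S Y Z ZW K \<longleftrightarrow>
     adapted F T Y \<and> continuous_process P T Y \<and>
     predictable F T Z \<and>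
     (\<forall>i. is_ito_integral P F T W (\<lambda>t \<omega>. Z t \<omega> $ i) (\<lambda>t \<omega>. ZW t \<omega> $ i)) \<and>
     adapted F T K \<and> continuous_process P T K \<and>
     (AE \<omega> in P. K 0 \<omega> = 0) \<and>
     (\<forall>i. AE \<omega> in P. mono_on {0..T} (\<lambda>t. K t \<omega> $ i)) \<and>
     (\<forall>i. \<forall>t\<in>{0..T}. AE \<omega> in P.
        Y t \<omega> $ i = \<xi> \<omega> $ i + (LINT s:{t..T}|lebesgue. f i \<omega> s (Y s \<omega>) (Z s \<omega> $ i))
          + K T \<omega> $ i - K t \<omega> $ i - (ZW T \<omega> $ i - ZW t \<omega> $ i)) \<and>
     (\<forall>i. \<forall>t\<in>{0..T}. AE \<omega> in P. S t \<omega> $ i \<le> Y t \<omega> $ i) \<and>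
     (\<forall>i. AE \<omega> in P.
        (LINT t:{0..T}|stieltjes_measure T (\<lambda>t. K t \<omega> $ i). Y t \<omega> $ i - S t \<omega> $ i) = 0)"

end

theory Submission
  imports Defs
begin

text \<open>
  Fix a component and write \<open>M\<close> for the martingale \<open>Z \<cdot> W\<close>. Along almost every path
  \<open>Y\<^sub>t = Y\<^sub>\<nu> + (\<integral> f over t..\<nu>) + (K\<^sub>\<nu> - K\<^sub>t) - (M\<^sub>\<nu> - M\<^sub>t)\<close>, and \<open>E\<^sub>t[M\<^sub>\<nu>] = M\<^sub>t\<close> by optional stopping.
  Since \<open>K\<close> is nondecreasing and \<open>Y\<close> dominates the obstacle, the reward of any \<open>\<nu>\<close> is at most
  \<open>Y\<^sub>t + (M\<^sub>\<nu> - M\<^sub>t)\<close>, whose conditional expectation is \<open>Y\<^sub>t\<close>. Equality holds for the first time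
  after \<open>t\<close> at which \<open>Y\<close> meets \<open>S\<close>, because the Skorokhod condition keeps \<open>K\<close> constant up to
  then. The reward need not be
  integrable; the integrable upper bound \<open>Y\<^sub>t + (M\<^sub>\<nu> - M\<^sub>t)\<close> suffices.
\<close>

section \<open>Complete filtrations\<close>

text \<open>Three kinds of exceptional set shape the proof. The equation and the obstacle condition
  hold for each fixed time outside a null set of that time, whereas a stopping time reads the path
  at a random time; continuity of the paths yields one null set for all times. Contact with the
  obstacle is a statement about almost every path, so the contact time is a stopping time because
  the filtration contains all null sets. The generator along the solution need not be jointly
  measurable, so a measurable function \<open>h\<close> that agrees with it almost everywhere
  carries the measurability of integrals up to a random time. The spaces enter as follows: BMO
  provides a martingale closed by its value at \<open>T\<close>; the uniform bound on
  \<open>Y\<close> makes \<open>Y\<close> integrable and, with the quadratic growth of the generator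
  and the pathwise square integrability of \<open>Z\<close>, makes the time integrals finite. Along
  the solution the generator is treated as a given process, which turns the coupled system into
  scalar stopping problems.\<close>

lemma le_on_dense:
  fixes f g :: "real \<Rightarrow> real"
  assumes "continuous_on A f" "continuous_on A g" "D \<subseteq> A" "A \<subseteq> closure D"
    and "\<And>x. x \<in> D \<Longrightarrow> f x \<le> g x" and "x \<in> A"
  shows "f x \<le> g x"
proof -
  obtain u where u: "\<And>n. u n \<in> D" "u \<longlonglongrightarrow> x"
    using assms(4,6) closure_sequential[of x D] by blast
  have uA: "\<forall>n. u n \<in> A" using u(1) assms(3) by blast
  have "(f \<circ> u) \<longlonglongrightarrow> f x" "(g \<circ> u) \<longlonglongrightarrow> g x"
    using assms(1,2,6) u(2) uA unfolding continuous_on_sequentially by blast+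
  then show ?thesis
    by (rule LIMSEQ_le) (use assms(5) u(1) in auto)
qed

text \<open>A countable dense set of times costs a single null set, and continuity carries the
  inequality to the remaining times. This makes the equation and the obstacle condition available at
  random times.\<close>

lemma AE_all_le:
  fixes X Y :: "real \<Rightarrow> 'a \<Rightarrow> real"
  assumes X: "AE \<omega> in P. continuous_on A (\<lambda>t. X t \<omega>)"
    and Y: "AE \<omega> in P. continuous_on A (\<lambda>t. Y t \<omega>)"
    and le: "\<And>t. t \<in> A \<Longrightarrow> AE \<omega> in P. X t \<omega> \<le> Y t \<omega>"
  shows "AE \<omega> in P. \<forall>t\<in>A. X t \<omega> \<le> Y t \<omega>"
proof -
  obtain D where D: "countable D" "D \<subseteq> A" "A \<subseteq> closure D"
    using separable[of A] by metis
  have "AE \<omega> in P. \<forall>t\<in>D. X t \<omega> \<le> Y t \<omega>"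
    using D(1,2) le by (subst AE_ball_countable) auto
  with X Y show ?thesis
    by eventually_elim (use le_on_dense[OF _ _ D(2,3)] in blast)
qed

lemma AE_all_eq:
  fixes X Y :: "real \<Rightarrow> 'a \<Rightarrow> real"
  assumes X: "AE \<omega> in P. continuous_on A (\<lambda>t. X t \<omega>)"
    and Y: "AE \<omega> in P. continuous_on A (\<lambda>t. Y t \<omega>)"
    and eq: "\<And>t. t \<in> A \<Longrightarrow> AE \<omega> in P. X t \<omega> = Y t \<omega>"
  shows "AE \<omega> in P. \<forall>t\<in>A. X t \<omega> = Y t \<omega>"
proof -
  have "AE \<omega> in P. \<forall>t\<in>A. X t \<omega> \<le> Y t \<omega>"
    using eq by (intro AE_all_le[OF X Y]) (force elim: eventually_mono)
  moreover have "AE \<omega> in P. \<forall>t\<in>A. Y t \<omega> \<le> X t \<omega>"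
    using eq by (intro AE_all_le[OF Y X]) (force elim: eventually_mono)
  ultimately show ?thesis by eventually_elim force
qed

text \<open>The preimages of a Borel set under \<open>f\<close> and \<open>g\<close> differ by a
  null set, which completeness makes measurable. The lemma serves for almost sure limits, for time
  integrals known up to a null set of scenarios, and for \<open>lebesgue\<close> as the completion
  of \<open>lborel\<close>.\<close>

lemma (in complete_measure) borel_measurable_cong_AE:
  fixes f g :: "'a \<Rightarrow> 'b::topological_space"
  assumes "f \<in> borel_measurable M" "AE x in M. f x = g x"
  shows "g \<in> borel_measurable M"
proof (rule measurableI)
  fix B :: "'b set" assume "B \<in> sets borel"
  with assms(1) have "f -` B \<inter> space M \<in> sets M" by (rule measurable_sets)
  then show "g -` B \<inter> space M \<in> sets M"
  proof (rule in_sets_AE[rotated])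
    show "AE x in M. x \<in> f -` B \<inter> space M \<longleftrightarrow> x \<in> g -` B \<inter> space M"
      using assms(2) by eventually_elim auto
  qed auto
qed simp

text \<open>Collects what the proof uses of the augmented Brownian filtration. Times range over all
  reals because \<open>stopping_time\<close> quantifies over all of them.\<close>

locale complete_filtration = prob_space P
  for P :: "'a measure" and F :: "real \<Rightarrow> 'a measure" +
  assumes subalg_F: "subalgebra P (F s)"
    and mono_F: "s \<le> t \<Longrightarrow> sets (F s) \<subseteq> sets (F t)"
    and null_sets_F: "N \<in> null_sets P \<Longrightarrow> A \<subseteq> N \<Longrightarrow> A \<in> sets (F s)"
begin

lemma space_F [simp]: "space (F s) = space P"
  using subalg_F[of s] by (simp add: subalgebra_def)

lemma sets_F_P: "A \<in> sets (F s) \<Longrightarrow> A \<in> sets P"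
  using subalg_F[of s] by (auto simp: subalgebra_def)

lemma measurable_F_P: "f \<in> measurable (F s) N \<Longrightarrow> f \<in> measurable P N"
  using measurable_from_subalg[OF subalg_F] .

lemma measurable_F_mono: "f \<in> measurable (F s) N \<Longrightarrow> s \<le> t \<Longrightarrow> f \<in> measurable (F t) N"
  using mono_F[of s t] by (auto simp: measurable_def)

lemma sigma_finite_subalgebra_F: "sigma_finite_subalgebra P (F s)"
  by (intro finite_measure_subalgebra_is_sigma_finite finite_measure_subalgebra.intro
      finite_measure_axioms finite_measure_subalgebra_axioms.intro subalg_F)

text \<open>\<open>A\<close> and \<open>B\<close> agree outside a null set \<open>N\<close>, and
  both \<open>N\<close> and the part of \<open>B\<close> inside it belong to \<open>F s\<close>.
  Events described through almost sure path properties thus remain observable at time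
  \<open>s\<close>.\<close>

lemma sets_F_cong_AE:
  assumes A: "A \<in> sets (F s)" and B: "B \<subseteq> space P" and eq: "AE \<omega> in P. \<omega> \<in> A \<longleftrightarrow> \<omega> \<in> B"
  shows "B \<in> sets (F s)"
proof -
  obtain N where N: "N \<in> null_sets P" "{\<omega>\<in>space P. \<not> (\<omega> \<in> A \<longleftrightarrow> \<omega> \<in> B)} \<subseteq> N"
    using eq unfolding eventually_ae_filter by blast
  have "A - N \<union> (B \<inter> N) \<in> sets (F s)"
    using A null_sets_F[OF N(1), of N] null_sets_F[OF N(1), of "B \<inter> N"] by auto
  moreover have "A - N \<union> (B \<inter> N) = B"
    using N(2) B sets.sets_into_space[OF A] by auto
  ultimately show ?thesis by simp
qed

end

sublocale complete_filtration \<subseteq> complete_measure P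
  using null_sets_F[of _ _ 0] sets_F_P by unfold_locales blast


section \<open>Extended real conditional expectations\<close>

text \<open>Passing from \<open>X\<close> to \<open>U\<close> raises the positive part and lowers
  the negative part, and \<open>ereal\<close> subtraction respects this even when both parts are
  infinite. Integrability is therefore not asked for, which is what a reward unbounded below calls
  for.\<close>

lemma ereal_cond_exp_mono:
  assumes "sigma_finite_subalgebra P G" "X \<in> borel_measurable P" "U \<in> borel_measurable P"
    and "AE \<omega> in P. X \<omega> \<le> U \<omega>"
  shows "AE \<omega> in P. ereal_cond_exp P G X \<omega> \<le> ereal_cond_exp P G U \<omega>"
proof -
  interpret sigma_finite_subalgebra P G by fact
  have "AE \<omega> in P. nn_cond_exp P G (\<lambda>\<omega>. ennreal (X \<omega>)) \<omega> \<le> nn_cond_exp P G (\<lambda>\<omega>. ennreal (U \<omega>)) \<omega>"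
    using assms by (intro nn_cond_exp_mono) (auto elim!: eventually_mono intro: ennreal_leI)
  moreover have "AE \<omega> in P. nn_cond_exp P G (\<lambda>\<omega>. ennreal (- U \<omega>)) \<omega> \<le> nn_cond_exp P G (\<lambda>\<omega>. ennreal (- X \<omega>)) \<omega>"
    using assms by (intro nn_cond_exp_mono) (auto elim!: eventually_mono intro: ennreal_leI)
  ultimately show ?thesis unfolding ereal_cond_exp_def
    by eventually_elim (auto intro!: ereal_minus_mono simp: less_eq_ennreal.rep_eq)
qed

text \<open>\<open>real_cond_exp\<close> is the same difference formed with \<open>enn2real\<close>,
  so the two agree where both parts are finite. Each part has the same integral as the variable that
  it conditions, hence is finite almost surely.\<close>

lemma ereal_cond_exp_eq_real_cond_exp:
  assumes "sigma_finite_subalgebra P G" "integrable P U"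
  shows "AE \<omega> in P. ereal_cond_exp P G U \<omega> = ereal (real_cond_exp P G U \<omega>)"
proof -
  interpret sigma_finite_subalgebra P G by fact
  have fin: "AE \<omega> in P. nn_cond_exp P G (\<lambda>\<omega>. ennreal (V \<omega>)) \<omega> \<noteq> \<infinity>" if V: "integrable P V" for V
  proof (rule nn_integral_PInf_AE)
    have "(\<integral>\<^sup>+\<omega>. 1 * nn_cond_exp P G (\<lambda>\<omega>. ennreal (V \<omega>)) \<omega> \<partial>P) = (\<integral>\<^sup>+\<omega>. 1 * ennreal (V \<omega>) \<partial>P)"
      using V by (intro nn_cond_exp_intg) auto
    also have "\<dots> \<noteq> \<infinity>"
      using V by (auto simp: real_integrable_def)
    finally show "(\<integral>\<^sup>+\<omega>. nn_cond_exp P G (\<lambda>\<omega>. ennreal (V \<omega>)) \<omega> \<partial>P) \<noteq> \<infinity>" by simp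
  qed simp
  have e: "enn2ereal x = ereal (enn2real x)" if "x \<noteq> \<infinity>" for x
    using that by (cases x) (auto simp: enn2ereal_ennreal)
  have "integrable P (\<lambda>\<omega>. - U \<omega>)" using assms(2) by simp
  from fin[OF assms(2)] fin[OF this] show ?thesis
    unfolding ereal_cond_exp_def real_cond_exp_def
    by eventually_elim (simp add: e)
qed

section \<open>Optional stopping\<close>

context complete_filtration
begin

lemma measurable_stopping_time_P: "stopping_time F \<nu> \<Longrightarrow> \<nu> \<in> borel_measurable P"
  by (rule measurable_stopping_time[of F]) (auto simp: sets_F_P)

lemma stopping_time_le_in_F:
  assumes "stopping_time F \<nu>" "r \<le> s"
  shows "{\<omega>\<in>space P. \<nu> \<omega> \<le> r} \<in> sets (F s)"
  using stopping_timeD[OF assms(1), of r] mono_F[OF assms(2)] by (auto simp: pred_def)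

text \<open>Finite range leaves finitely many earlier values to remove from the event that
  \<open>\<tau>\<close> is at most \<open>s\<close>, and each of them is decided by time
  \<open>s\<close>.\<close>

lemma finite_stopping_time_eq_in_F:
  assumes "stopping_time F \<tau>" and fin: "finite (\<tau> ` space P)"
  shows "{\<omega>\<in>space P. \<tau> \<omega> = s} \<in> sets (F s)"
proof -
  have "{\<omega>\<in>space P. \<tau> \<omega> = s} =
      {\<omega>\<in>space P. \<tau> \<omega> \<le> s} - (\<Union>r\<in>{r \<in> \<tau> ` space P. r < s}. {\<omega>\<in>space P. \<tau> \<omega> \<le> r})"
    by auto
  also have "\<dots> \<in> sets (F s)"
    using fin by (intro sets.Diff sets.finite_UN stopping_time_le_in_F[OF assms(1)]) auto
  finally show ?thesis .
qed

end

text \<open>The martingale property is recorded against the terminal value, because every stopping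
  identity below converts an earlier value into \<open>M T\<close>.\<close>

locale closed_martingale = complete_filtration P F
  for P :: "'a measure" and F +
  fixes T :: real and M :: "real \<Rightarrow> 'a \<Rightarrow> real"
  assumes T: "0 \<le> T"
    and M_adapted: "s \<in> {0..T} \<Longrightarrow> M s \<in> borel_measurable (F s)"
    and M_integrable: "integrable P (M T)"
    and M_cond_exp: "s \<in> {0..T} \<Longrightarrow> AE \<omega> in P. M s \<omega> = real_cond_exp P (F s) (M T) \<omega>"
begin

lemma M_measurable: "s \<in> {0..T} \<Longrightarrow> M s \<in> borel_measurable P"
  using M_adapted measurable_F_P by blast

lemma M_integrable_all: "s \<in> {0..T} \<Longrightarrow> integrable P (M s)"
proof -
  assume s: "s \<in> {0..T}"
  interpret sigma_finite_subalgebra P "F s" by (rule sigma_finite_subalgebra_F)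
  show ?thesis
    using integrable_cong_AE[OF M_measurable[OF s] _ M_cond_exp[OF s]]
      real_cond_exp_int(1)[OF M_integrable] by auto
qed

text \<open>A bounded \<open>g\<close> keeps the products integrable, so the defining property of
  conditional expectation applies. The bound 1 covers all later test functions: indicators,
  \<open>sgn\<close> and the truncations.\<close>

lemma integral_mult_M_eq:
  assumes s: "s \<in> {0..T}" and g: "g \<in> borel_measurable (F s)"
    and bound: "\<And>\<omega>. \<bar>g \<omega>\<bar> \<le> 1"
  shows "integrable P (\<lambda>\<omega>. g \<omega> * M s \<omega>)" "(\<integral>\<omega>. g \<omega> * M s \<omega> \<partial>P) = (\<integral>\<omega>. g \<omega> * M T \<omega> \<partial>P)"
proof -
  interpret sigma_finite_subalgebra P "F s" by (rule sigma_finite_subalgebra_F)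
  have gP: "g \<in> borel_measurable P" using g measurable_F_P by blast
  have "\<bar>g \<omega> * x\<bar> \<le> \<bar>x\<bar>" for \<omega> and x :: real
    using bound[of \<omega>] by (simp add: abs_mult mult_left_le_one_le)
  then have int: "integrable P (\<lambda>\<omega>. g \<omega> * X \<omega>)" if "integrable P X" for X :: "'a \<Rightarrow> real"
    using that gP by (intro Bochner_Integration.integrable_bound[OF that]) auto
  show "integrable P (\<lambda>\<omega>. g \<omega> * M s \<omega>)"
    using int M_integrable_all[OF s] by blast
  have "(\<integral>\<omega>. g \<omega> * M s \<omega> \<partial>P) = (\<integral>\<omega>. g \<omega> * real_cond_exp P (F s) (M T) \<omega> \<partial>P)"
  proof (rule integral_cong_AE)
    show "AE \<omega> in P. g \<omega> * M s \<omega> = g \<omega> * real_cond_exp P (F s) (M T) \<omega>"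
      using M_cond_exp[OF s] by eventually_elim simp
  qed (use gP M_measurable[OF s] in auto)
  also have "\<dots> = (\<integral>\<omega>. g \<omega> * M T \<omega> \<partial>P)"
    using M_integrable by (intro real_cond_exp_intg int g) auto
  finally show "(\<integral>\<omega>. g \<omega> * M s \<omega> \<partial>P) = (\<integral>\<omega>. g \<omega> * M T \<omega> \<partial>P)" .
qed

context
  fixes \<tau> :: "'a \<Rightarrow> real" and t :: real
  assumes \<tau>: "stopping_time F \<tau>" and fin: "finite (\<tau> ` space P)"
    and ran: "\<tau> ` space P \<subseteq> {t..T}" and t: "0 \<le> t"
begin

lemma stopped_eq_sum:
  fixes \<phi> :: "real \<Rightarrow> 'a \<Rightarrow> real"
  shows "\<omega> \<in> space P \<Longrightarrow>
    \<phi> (\<tau> \<omega>) \<omega> = (\<Sum>s\<in>\<tau> ` space P. indicator {\<omega>\<in>space P. \<tau> \<omega> = s} \<omega> * \<phi> s \<omega>)"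
  using fin by (subst sum.remove[of _ "\<tau> \<omega>"]) (auto intro!: sum.neutral simp: indicator_def)

lemma stopped_range: "s \<in> \<tau> ` space P \<Longrightarrow> s \<in> {0..T}"
  using ran t by auto

lemma stopped_measurable: "(\<lambda>\<omega>. M (\<tau> \<omega>) \<omega>) \<in> borel_measurable P"
proof -
  have "(\<lambda>\<omega>. \<Sum>s\<in>\<tau> ` space P. indicator {\<omega>\<in>space P. \<tau> \<omega> = s} \<omega> * M s \<omega>) \<in> borel_measurable P"
    using M_measurable[OF stopped_range] finite_stopping_time_eq_in_F[OF \<tau> fin, THEN sets_F_P]
    by (intro borel_measurable_sum borel_measurable_times borel_measurable_indicator) auto
  then show ?thesis
    by (subst measurable_cong[OF stopped_eq_sum]) auto
qed

text \<open>Where \<open>\<tau>\<close> equals \<open>s\<close>, the test factor is that of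
  \<open>M s\<close>; it is known at time \<open>s\<close>, since \<open>A\<close> is already known
  at time \<open>t \<le> s\<close>. There \<open>M s\<close> may be replaced by \<open>M T\<close>,
  and the finitely many pieces are added up. Letting the factor depend on the stopped value serves
  both the uniform bound and the truncation.\<close>

lemma integral_stopped_mult:
  assumes A: "A \<in> sets (F t)" and \<psi>: "\<psi> \<in> borel_measurable borel" "\<And>x::real. \<bar>\<psi> x\<bar> \<le> (1::real)"
  shows "integrable P (\<lambda>\<omega>. indicator A \<omega> * \<psi> (M (\<tau> \<omega>) \<omega>) * M (\<tau> \<omega>) \<omega>)"
    and "(\<integral>\<omega>. indicator A \<omega> * \<psi> (M (\<tau> \<omega>) \<omega>) * M (\<tau> \<omega>) \<omega> \<partial>P) =
         (\<integral>\<omega>. indicator A \<omega> * \<psi> (M (\<tau> \<omega>) \<omega>) * M T \<omega> \<partial>P)"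
proof -
  define B where "B s = {\<omega>\<in>space P. \<tau> \<omega> = s}" for s
  define g where "g s \<omega> = indicator (B s) \<omega> * (indicator A \<omega> * \<psi> (M s \<omega>))" for s \<omega>
  have g: "g s \<in> borel_measurable (F s)" if s: "s \<in> \<tau> ` space P" for s
  proof -
    have "t \<le> s" using ran s by auto
    then have "A \<in> sets (F s)" "B s \<in> sets (F s)"
      using A mono_F[of t s] finite_stopping_time_eq_in_F[OF \<tau> fin] by (auto simp: B_def)
    then show ?thesis
      using M_adapted[OF stopped_range[OF s]] \<psi>(1) unfolding g_def by measurable
  qed
  have bound: "\<bar>g s \<omega>\<bar> \<le> 1" for s \<omega>
    using \<psi>(2) by (auto simp: g_def indicator_def)
  note M = integral_mult_M_eq[OF stopped_range g bound]
  have MT: "integrable P (\<lambda>\<omega>. g s \<omega> * M T \<omega>)" if s: "s \<in> \<tau> ` space P" for s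
    using integral_mult_M_eq(1)[OF _ measurable_F_mono[OF g[OF s]] bound, of T] stopped_range[OF s] T by auto
  have eq: "indicator A \<omega> * \<psi> (M (\<tau> \<omega>) \<omega>) * M (\<tau> \<omega>) \<omega> = (\<Sum>s\<in>\<tau> ` space P. g s \<omega> * M s \<omega>)"
    if "\<omega> \<in> space P" for \<omega>
    using stopped_eq_sum[OF that, of "\<lambda>s \<omega>. indicator A \<omega> * \<psi> (M s \<omega>) * M s \<omega>"]
    by (simp add: g_def B_def mult.assoc)
  have eqT: "indicator A \<omega> * \<psi> (M (\<tau> \<omega>) \<omega>) * M T \<omega> = (\<Sum>s\<in>\<tau> ` space P. g s \<omega> * M T \<omega>)"
    if "\<omega> \<in> space P" for \<omega>
    using stopped_eq_sum[OF that, of "\<lambda>s \<omega>. indicator A \<omega> * \<psi> (M s \<omega>) * M T \<omega>"]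
    by (simp add: g_def B_def mult.assoc)
  show "integrable P (\<lambda>\<omega>. indicator A \<omega> * \<psi> (M (\<tau> \<omega>) \<omega>) * M (\<tau> \<omega>) \<omega>)"
    using M(1) by (subst Bochner_Integration.integrable_cong[OF refl eq]) auto
  have "(\<integral>\<omega>. indicator A \<omega> * \<psi> (M (\<tau> \<omega>) \<omega>) * M (\<tau> \<omega>) \<omega> \<partial>P) = (\<Sum>s\<in>\<tau> ` space P. \<integral>\<omega>. g s \<omega> * M s \<omega> \<partial>P)"
    using M(1) by (subst Bochner_Integration.integral_cong[OF refl eq]) (auto intro!: Bochner_Integration.integral_sum)
  also have "\<dots> = (\<Sum>s\<in>\<tau> ` space P. \<integral>\<omega>. g s \<omega> * M T \<omega> \<partial>P)"
    using M(2) by simp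
  also have "\<dots> = (\<integral>\<omega>. indicator A \<omega> * \<psi> (M (\<tau> \<omega>) \<omega>) * M T \<omega> \<partial>P)"
    using MT by (subst Bochner_Integration.integral_cong[OF refl eqT]) (auto intro!: Bochner_Integration.integral_sum[symmetric])
  finally show "(\<integral>\<omega>. indicator A \<omega> * \<psi> (M (\<tau> \<omega>) \<omega>) * M (\<tau> \<omega>) \<omega> \<partial>P) =
         (\<integral>\<omega>. indicator A \<omega> * \<psi> (M (\<tau> \<omega>) \<omega>) * M T \<omega> \<partial>P)" .
qed

text \<open>With \<open>sgn\<close> as test function on the whole space, the stopped side of the
  identity is the absolute value and the terminal side is at most the mean of
  \<open>\<bar>M T \<omega>\<bar>\<close>. The bound does not depend on
  \<open>\<tau>\<close>.\<close>

lemma nn_integral_stopped_le: "(\<integral>\<^sup>+\<omega>. ennreal \<bar>M (\<tau> \<omega>) \<omega>\<bar> \<partial>P) \<le> ennreal (\<integral>\<omega>. \<bar>M T \<omega>\<bar> \<partial>P)"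
proof -
  have top: "space P \<in> sets (F t)" using sets.top[of "F t"] by simp
  have s: "(sgn :: real \<Rightarrow> real) \<in> borel_measurable borel" "\<And>x::real. \<bar>sgn x\<bar> \<le> 1"
    by (auto simp: sgn_if)
  note I = integral_stopped_mult[OF top s]
  have e: "indicator (space P) \<omega> * sgn (M (\<tau> \<omega>) \<omega>) * M (\<tau> \<omega>) \<omega> = \<bar>M (\<tau> \<omega>) \<omega>\<bar>"
    if "\<omega> \<in> space P" for \<omega>
    using that by (auto simp: sgn_if)
  have "integrable P (\<lambda>\<omega>. \<bar>M (\<tau> \<omega>) \<omega>\<bar>)"
    using I(1) by (subst (asm) Bochner_Integration.integrable_cong[OF refl e]) auto
  then have "(\<integral>\<^sup>+\<omega>. ennreal \<bar>M (\<tau> \<omega>) \<omega>\<bar> \<partial>P) = ennreal (\<integral>\<omega>. \<bar>M (\<tau> \<omega>) \<omega>\<bar> \<partial>P)"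
    by (rule nn_integral_eq_integral) simp
  also have "(\<integral>\<omega>. \<bar>M (\<tau> \<omega>) \<omega>\<bar> \<partial>P) = (\<integral>\<omega>. indicator (space P) \<omega> * sgn (M (\<tau> \<omega>) \<omega>) * M T \<omega> \<partial>P)"
    using I(2) by (subst (asm) Bochner_Integration.integral_cong[OF refl e]) auto
  also have "\<dots> \<le> (\<integral>\<omega>. \<bar>M T \<omega>\<bar> \<partial>P)"
    using M_integrable by (intro integral_mono') (auto simp: sgn_if)
  finally show ?thesis by (simp add: ennreal_leI)
qed

end

text \<open>
  \<open>\<nu>\<close> is approximated from above by finitely valued stopping times \<open>\<tau> n\<close>. To pass to the limit
  without uniform integrability of the stopped variables, the martingale identity is tested
  against \<open>\<psi> k (M\<^sub>\<tau>)\<close> with \<open>\<psi> k x = (k + 1) / (k + 1 + \<bar>x\<bar>)\<close>, which makes the integrand bounded; then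
  \<open>k\<close> tends to infinity.
\<close>

lemma optional_stopping:
  assumes cont: "AE \<omega> in P. continuous_on {0..T} (\<lambda>t. M t \<omega>)"
    and \<nu>: "\<nu> \<in> stopping_times_between P F t T" and t: "t \<in> {0..T}"
  shows "integrable P (\<lambda>\<omega>. M (\<nu> \<omega>) \<omega>)"
    and "AE \<omega> in P. real_cond_exp P (F t) (\<lambda>\<omega>. M (\<nu> \<omega>) \<omega>) \<omega> = M t \<omega>"
proof -
  have st: "stopping_time F \<nu>" and bd: "\<And>\<omega>. \<omega> \<in> space P \<Longrightarrow> t \<le> \<nu> \<omega> \<and> \<nu> \<omega> \<le> T"
    using \<nu> by (auto simp: stopping_times_between_def)
  \<comment> \<open>This is \<open>\<nu>\<close> rounded up to a multiple of 1/(n+1) and capped at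
    \<open>T\<close>. For \<open>s < T\<close>, rounding up makes
    \<open>\<tau> n \<omega> \<le> s\<close> equivalent to \<open>\<nu> \<omega> \<le> r\<close>,
    where \<open>r\<close> is the largest multiple not exceeding \<open>s\<close>; hence the
    stopping property is inherited.\<close>
  define \<tau> where "\<tau> n \<omega> = min T (real_of_int \<lceil>real (Suc n) * \<nu> \<omega>\<rceil> / real (Suc n))" for n \<omega>
  have le: "\<nu> \<omega> \<le> \<tau> n \<omega>" "\<tau> n \<omega> \<le> T" "\<tau> n \<omega> \<le> \<nu> \<omega> + 1 / real (Suc n)" if "\<omega> \<in> space P" for n \<omega>
  proof -
    have "real (Suc n) * \<nu> \<omega> \<le> real_of_int \<lceil>real (Suc n) * \<nu> \<omega>\<rceil>" by (rule le_of_int_ceiling)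
    then have "\<nu> \<omega> \<le> real_of_int \<lceil>real (Suc n) * \<nu> \<omega>\<rceil> / real (Suc n)"
      by (simp add: pos_le_divide_eq mult.commute del: of_nat_Suc)
    then show "\<nu> \<omega> \<le> \<tau> n \<omega>" using bd[OF that] by (simp add: \<tau>_def)
    show "\<tau> n \<omega> \<le> T" by (simp add: \<tau>_def)
    have "real_of_int \<lceil>real (Suc n) * \<nu> \<omega>\<rceil> \<le> real (Suc n) * \<nu> \<omega> + 1" by linarith
    then have "real_of_int \<lceil>real (Suc n) * \<nu> \<omega>\<rceil> / real (Suc n) \<le> (real (Suc n) * \<nu> \<omega> + 1) / real (Suc n)"
      by (intro divide_right_mono) auto
    also have "\<dots> = \<nu> \<omega> + 1 / real (Suc n)"
      by (simp add: add_divide_distrib del: of_nat_Suc)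
    finally show "\<tau> n \<omega> \<le> \<nu> \<omega> + 1 / real (Suc n)" by (simp add: \<tau>_def)
  qed
  have \<tau>_ran: "\<tau> n ` space P \<subseteq> {t..T}" for n
    using order_trans[OF conjunct1[OF bd] le(1)] le(2) by (auto simp: image_subset_iff)
  have \<tau>_fin: "finite (\<tau> n ` space P)" for n
  proof -
    have "\<lceil>real (Suc n) * \<nu> \<omega>\<rceil> \<in> {0..\<lceil>real (Suc n) * T\<rceil>}" if "\<omega> \<in> space P" for \<omega>
    proof -
      have "0 \<le> real (Suc n) * \<nu> \<omega>" "real (Suc n) * \<nu> \<omega> \<le> real (Suc n) * T"
        using bd[OF that] t by (auto intro!: mult_left_mono mult_nonneg_nonneg)
      then show ?thesis by (auto intro: ceiling_mono simp del: of_nat_Suc)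
    qed
    then have "\<tau> n ` space P \<subseteq> (\<lambda>k. min T (real_of_int k / real (Suc n))) ` {0..\<lceil>real (Suc n) * T\<rceil>}"
      unfolding \<tau>_def by blast
    then show ?thesis by (rule finite_subset) simp
  qed
  have \<tau>_st: "stopping_time F (\<tau> n)" for n
  proof (rule stopping_timeI)
    fix s
    show "Measurable.pred (F s) (\<lambda>\<omega>. \<tau> n \<omega> \<le> s)"
    proof (cases "T \<le> s")
      case True
      then have "(\<lambda>\<omega>. \<tau> n \<omega> \<le> s) = (\<lambda>_. True)" by (auto simp: \<tau>_def fun_eq_iff)
      then show ?thesis by simp
    next
      case False
      have *: "\<tau> n \<omega> \<le> s \<longleftrightarrow> \<nu> \<omega> \<le> real_of_int \<lfloor>real (Suc n) * s\<rfloor> / real (Suc n)" for \<omega>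
      proof -
        have "\<tau> n \<omega> \<le> s \<longleftrightarrow> real_of_int \<lceil>real (Suc n) * \<nu> \<omega>\<rceil> \<le> real (Suc n) * s"
          using False by (simp add: \<tau>_def min_le_iff_disj pos_divide_le_eq mult.commute del: of_nat_Suc)
        also have "\<dots> \<longleftrightarrow> \<lceil>real (Suc n) * \<nu> \<omega>\<rceil> \<le> \<lfloor>real (Suc n) * s\<rfloor>"
          by (simp add: le_floor_iff del: of_nat_Suc)
        also have "\<dots> \<longleftrightarrow> real (Suc n) * \<nu> \<omega> \<le> real_of_int \<lfloor>real (Suc n) * s\<rfloor>"
          by (simp add: ceiling_le_iff del: of_nat_Suc)
        also have "\<dots> \<longleftrightarrow> \<nu> \<omega> \<le> real_of_int \<lfloor>real (Suc n) * s\<rfloor> / real (Suc n)"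
          by (simp add: pos_le_divide_eq mult.commute del: of_nat_Suc)
        finally show ?thesis .
      qed
      have "real_of_int \<lfloor>real (Suc n) * s\<rfloor> / real (Suc n) \<le> s"
        by (simp add: pos_divide_le_eq mult.commute del: of_nat_Suc)
      then show ?thesis
        unfolding * using stopping_time_le_in_F[OF st] by (simp add: pred_def)
    qed
  qed
  have t0: "0 \<le> t" using t by simp
  note stp = \<tau>_st \<tau>_fin \<tau>_ran t0
  have Mm: "(\<lambda>\<omega>. M (\<tau> n \<omega>) \<omega>) \<in> borel_measurable P" for n
    by (rule stopped_measurable[OF stp])
  have lim: "AE \<omega> in P. (\<lambda>n. M (\<tau> n \<omega>) \<omega>) \<longlonglongrightarrow> M (\<nu> \<omega>) \<omega>"
    using cont AE_space
  proof eventually_elim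
    case (elim \<omega>)
    have "(\<lambda>n. \<tau> n \<omega>) \<longlonglongrightarrow> \<nu> \<omega>"
    proof (rule tendsto_sandwich[where f="\<lambda>_. \<nu> \<omega>" and h="\<lambda>n. \<nu> \<omega> + 1 / real (Suc n)"])
      show "(\<lambda>n. \<nu> \<omega> + 1 / real (Suc n)) \<longlonglongrightarrow> \<nu> \<omega>"
        using tendsto_add[OF tendsto_const LIMSEQ_inverse_real_of_nat, of "\<nu> \<omega>"]
        by (simp add: inverse_eq_divide)
    qed (use le[OF elim(2)] in auto)
    moreover have "\<forall>n. \<tau> n \<omega> \<in> {0..T}"
      using \<tau>_ran t0 elim(2) by (auto simp: image_subset_iff intro: order_trans)
    moreover have "\<nu> \<omega> \<in> {0..T}"
      using t0 bd[OF elim(2)] by auto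
    ultimately show ?case
      by (intro continuous_on_tendsto_compose[OF elim(1)]) auto
  qed
  have M\<nu>: "(\<lambda>\<omega>. M (\<nu> \<omega>) \<omega>) \<in> borel_measurable P"
  proof (rule borel_measurable_cong_AE)
    show "(\<lambda>\<omega>. lim (\<lambda>n. M (\<tau> n \<omega>) \<omega>)) \<in> borel_measurable P"
      using Mm by measurable
    show "AE \<omega> in P. lim (\<lambda>n. M (\<tau> n \<omega>) \<omega>) = M (\<nu> \<omega>) \<omega>"
      using lim by eventually_elim (rule limI)
  qed
  \<comment> \<open>Fatou's lemma: the approximating stopped variables have first absolute moments
    bounded by that of \<open>M T\<close>.\<close>
  show int: "integrable P (\<lambda>\<omega>. M (\<nu> \<omega>) \<omega>)"
  proof (rule integrableI_bounded[OF M\<nu>])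
    have "(\<integral>\<^sup>+\<omega>. ennreal (norm (M (\<nu> \<omega>) \<omega>)) \<partial>P) = (\<integral>\<^sup>+\<omega>. liminf (\<lambda>n. ennreal \<bar>M (\<tau> n \<omega>) \<omega>\<bar>) \<partial>P)"
    proof (rule nn_integral_cong_AE)
      show "AE \<omega> in P. ennreal (norm (M (\<nu> \<omega>) \<omega>)) = liminf (\<lambda>n. ennreal \<bar>M (\<tau> n \<omega>) \<omega>\<bar>)"
        using lim by eventually_elim
          (auto intro!: lim_imp_Liminf[symmetric] tendsto_ennrealI tendsto_rabs)
    qed
    also have "\<dots> \<le> liminf (\<lambda>n. \<integral>\<^sup>+\<omega>. ennreal \<bar>M (\<tau> n \<omega>) \<omega>\<bar> \<partial>P)"
      using Mm by (intro nn_integral_liminf) auto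
    also have "\<dots> \<le> liminf (\<lambda>n::nat. ennreal (\<integral>\<omega>. \<bar>M T \<omega>\<bar> \<partial>P))"
      by (intro Liminf_mono always_eventually allI nn_integral_stopped_le[OF stp])
    also have "\<dots> < \<infinity>" by (simp add: Liminf_const)
    finally show "(\<integral>\<^sup>+\<omega>. ennreal (norm (M (\<nu> \<omega>) \<omega>)) \<partial>P) < \<infinity>" .
  qed
  have cut: "(\<integral>\<omega>. indicator A \<omega> * M (\<nu> \<omega>) \<omega> \<partial>P) = (\<integral>\<omega>. indicator A \<omega> * M T \<omega> \<partial>P)"
    if A: "A \<in> sets (F t)" for A
  proof -
    have AP: "A \<in> sets P" using A by (rule sets_F_P)
    define \<psi> where "\<psi> k x = real (Suc k) / (real (Suc k) + \<bar>x\<bar>)" for k and x :: real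
    have pos: "0 < real (Suc k) + \<bar>x\<bar>" for k and x :: real by linarith
    have \<psi>1: "\<bar>\<psi> k x\<bar> \<le> 1" for k x using pos[of k x] by (simp add: \<psi>_def)
    have \<psi>2: "\<bar>\<psi> k x * x\<bar> \<le> real (Suc k)" for k x
      using pos[of k x] mult_left_mono[of "\<bar>x\<bar>" "real (Suc k) + \<bar>x\<bar>" "real (Suc k)"]
      by (simp add: \<psi>_def abs_mult pos_divide_le_eq)
    have \<psi>c: "isCont (\<psi> k) x" for k x
      using pos[of k x] unfolding \<psi>_def by (intro continuous_intros) auto
    have \<psi>m [measurable]: "\<psi> k \<in> borel_measurable borel" for k
      unfolding \<psi>_def by measurable
    have \<psi>l: "(\<lambda>k. \<psi> k x) \<longlonglongrightarrow> 1" for x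
    proof -
      have "(\<lambda>k. 1 / (1 + \<bar>x\<bar> * inverse (real (Suc k)))) \<longlonglongrightarrow> 1 / (1 + \<bar>x\<bar> * 0)"
        by (intro tendsto_intros LIMSEQ_inverse_real_of_nat) auto
      moreover have "1 / (1 + \<bar>x\<bar> * inverse (real (Suc k))) = \<psi> k x" for k
        using pos[of k x] by (simp add: \<psi>_def field_simps)
      ultimately show ?thesis by simp
    qed
    \<comment> \<open>For fixed \<open>k\<close> the stopped side is dominated by the constant
      \<open>k + 1\<close> and the terminal side by \<open>\<bar>M T \<omega>\<bar>\<close>, so both
      limits in \<open>n\<close> are dominated convergence.\<close>
    have eq: "(\<integral>\<omega>. indicator A \<omega> * \<psi> k (M (\<nu> \<omega>) \<omega>) * M (\<nu> \<omega>) \<omega> \<partial>P) =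
        (\<integral>\<omega>. indicator A \<omega> * \<psi> k (M (\<nu> \<omega>) \<omega>) * M T \<omega> \<partial>P)" for k
    proof (rule LIMSEQ_unique)
      show "(\<lambda>n. \<integral>\<omega>. indicator A \<omega> * \<psi> k (M (\<tau> n \<omega>) \<omega>) * M (\<tau> n \<omega>) \<omega> \<partial>P) \<longlonglongrightarrow>
        (\<integral>\<omega>. indicator A \<omega> * \<psi> k (M (\<nu> \<omega>) \<omega>) * M (\<nu> \<omega>) \<omega> \<partial>P)"
      proof (rule integral_dominated_convergence[where w="\<lambda>_. real (Suc k)"])
        show "AE \<omega> in P. (\<lambda>n. indicator A \<omega> * \<psi> k (M (\<tau> n \<omega>) \<omega>) * M (\<tau> n \<omega>) \<omega>)
            \<longlonglongrightarrow> indicator A \<omega> * \<psi> k (M (\<nu> \<omega>) \<omega>) * M (\<nu> \<omega>) \<omega>"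
          using lim by eventually_elim (intro tendsto_intros isCont_tendsto_compose[OF \<psi>c])
        show "AE \<omega> in P. norm (indicator A \<omega> * \<psi> k (M (\<tau> n \<omega>) \<omega>) * M (\<tau> n \<omega>) \<omega>) \<le> real (Suc k)" for n
          using \<psi>2 by (intro AE_I2) (auto simp: indicator_def)
      qed (use Mm M\<nu> AP in measurable)
      show "(\<lambda>n. \<integral>\<omega>. indicator A \<omega> * \<psi> k (M (\<tau> n \<omega>) \<omega>) * M (\<tau> n \<omega>) \<omega> \<partial>P) \<longlonglongrightarrow>
        (\<integral>\<omega>. indicator A \<omega> * \<psi> k (M (\<nu> \<omega>) \<omega>) * M T \<omega> \<partial>P)"
        unfolding integral_stopped_mult(2)[OF stp A \<psi>m \<psi>1]
      proof (rule integral_dominated_convergence[where w="\<lambda>\<omega>. \<bar>M T \<omega>\<bar>"])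
        show "integrable P (\<lambda>\<omega>. \<bar>M T \<omega>\<bar>)" using M_integrable by (rule integrable_abs)
        show "AE \<omega> in P. (\<lambda>n. indicator A \<omega> * \<psi> k (M (\<tau> n \<omega>) \<omega>) * M T \<omega>)
            \<longlonglongrightarrow> indicator A \<omega> * \<psi> k (M (\<nu> \<omega>) \<omega>) * M T \<omega>"
          using lim by eventually_elim (intro tendsto_intros isCont_tendsto_compose[OF \<psi>c])
        show "AE \<omega> in P. norm (indicator A \<omega> * \<psi> k (M (\<tau> n \<omega>) \<omega>) * M T \<omega>) \<le> \<bar>M T \<omega>\<bar>" for n
          using \<psi>1 by (intro AE_I2) (auto simp: indicator_def abs_mult mult_left_le_one_le)
      qed (use Mm M\<nu> AP M_integrable in measurable)
    qed
    \<comment> \<open>As \<open>k\<close> grows, the dominating function on the stopped side is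
      \<open>\<bar>M (\<nu> \<omega>) \<omega>\<bar>\<close>, integrable by the Fatou bound
      above.\<close>
    show ?thesis
    proof (rule LIMSEQ_unique)
      show "(\<lambda>k. \<integral>\<omega>. indicator A \<omega> * \<psi> k (M (\<nu> \<omega>) \<omega>) * M (\<nu> \<omega>) \<omega> \<partial>P) \<longlonglongrightarrow>
        (\<integral>\<omega>. indicator A \<omega> * M (\<nu> \<omega>) \<omega> \<partial>P)"
      proof (rule integral_dominated_convergence[where w="\<lambda>\<omega>. \<bar>M (\<nu> \<omega>) \<omega>\<bar>"])
        show "integrable P (\<lambda>\<omega>. \<bar>M (\<nu> \<omega>) \<omega>\<bar>)" using int by (rule integrable_abs)
        show "AE \<omega> in P. (\<lambda>k. indicator A \<omega> * \<psi> k (M (\<nu> \<omega>) \<omega>) * M (\<nu> \<omega>) \<omega>)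
            \<longlonglongrightarrow> indicator A \<omega> * M (\<nu> \<omega>) \<omega>"
        proof (rule AE_I2)
          fix \<omega>
          have "(\<lambda>k. indicator A \<omega> * \<psi> k (M (\<nu> \<omega>) \<omega>) * M (\<nu> \<omega>) \<omega>)
            \<longlonglongrightarrow> indicator A \<omega> * 1 * M (\<nu> \<omega>) \<omega>"
            by (intro tendsto_intros \<psi>l)
          then show "(\<lambda>k. indicator A \<omega> * \<psi> k (M (\<nu> \<omega>) \<omega>) * M (\<nu> \<omega>) \<omega>)
            \<longlonglongrightarrow> indicator A \<omega> * M (\<nu> \<omega>) \<omega>" by simp
        qed
        show "AE \<omega> in P. norm (indicator A \<omega> * \<psi> k (M (\<nu> \<omega>) \<omega>) * M (\<nu> \<omega>) \<omega>) \<le> \<bar>M (\<nu> \<omega>) \<omega>\<bar>" for k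
          using \<psi>1 by (intro AE_I2) (auto simp: indicator_def abs_mult mult_left_le_one_le)
      qed (use M\<nu> AP int in measurable)
      show "(\<lambda>k. \<integral>\<omega>. indicator A \<omega> * \<psi> k (M (\<nu> \<omega>) \<omega>) * M (\<nu> \<omega>) \<omega> \<partial>P) \<longlonglongrightarrow>
        (\<integral>\<omega>. indicator A \<omega> * M T \<omega> \<partial>P)"
        unfolding eq
      proof (rule integral_dominated_convergence[where w="\<lambda>\<omega>. \<bar>M T \<omega>\<bar>"])
        show "integrable P (\<lambda>\<omega>. \<bar>M T \<omega>\<bar>)" using M_integrable by (rule integrable_abs)
        show "AE \<omega> in P. (\<lambda>k. indicator A \<omega> * \<psi> k (M (\<nu> \<omega>) \<omega>) * M T \<omega>)
            \<longlonglongrightarrow> indicator A \<omega> * M T \<omega>"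
        proof (rule AE_I2)
          fix \<omega>
          have "(\<lambda>k. indicator A \<omega> * \<psi> k (M (\<nu> \<omega>) \<omega>) * M T \<omega>)
            \<longlonglongrightarrow> indicator A \<omega> * 1 * M T \<omega>"
            by (intro tendsto_intros \<psi>l)
          then show "(\<lambda>k. indicator A \<omega> * \<psi> k (M (\<nu> \<omega>) \<omega>) * M T \<omega>)
            \<longlonglongrightarrow> indicator A \<omega> * M T \<omega>" by simp
        qed
        show "AE \<omega> in P. norm (indicator A \<omega> * \<psi> k (M (\<nu> \<omega>) \<omega>) * M T \<omega>) \<le> \<bar>M T \<omega>\<bar>" for k
          using \<psi>1 by (intro AE_I2) (auto simp: indicator_def abs_mult mult_left_le_one_le)
      qed (use M\<nu> AP M_integrable in measurable)
    qed
  qed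
  interpret sigma_finite_subalgebra P "F t" by (rule sigma_finite_subalgebra_F)
  show "AE \<omega> in P. real_cond_exp P (F t) (\<lambda>\<omega>. M (\<nu> \<omega>) \<omega>) \<omega> = M t \<omega>"
  proof (rule real_cond_exp_charact)
    fix A assume A: "A \<in> sets (F t)"
    have "(\<integral>\<omega>. indicator A \<omega> * M t \<omega> \<partial>P) = (\<integral>\<omega>. indicator A \<omega> * M T \<omega> \<partial>P)"
      using A by (intro integral_mult_M_eq t) (auto simp: indicator_def)
    with cut[OF A] show "(\<integral>\<omega>\<in>A. M (\<nu> \<omega>) \<omega> \<partial>P) = (\<integral>\<omega>\<in>A. M t \<omega> \<partial>P)"
      by (simp add: set_lebesgue_integral_def)
  qed (use int M_integrable_all M_adapted t in auto)
qed

end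

section \<open>Pathwise facts and measurability of the time integrals\<close>

text \<open>A nonnegative \<open>g\<close> with zero integral vanishes almost everywhere for the
  Stieltjes measure of \<open>k\<close>, so \<open>{a..<b}\<close> is a null set. Its subintervals
  \<open>{a<..c}\<close> have measure \<open>k c - k a\<close>, which makes \<open>k\<close>
  constant up to every \<open>c < b\<close>; continuity then reaches \<open>b\<close>, where
  \<open>g\<close> may vanish, as it does at the first contact with the obstacle.\<close>

lemma skorokhod_flat:
  fixes k g :: "real \<Rightarrow> real"
  assumes T: "0 \<le> T" and k: "continuous_on {0..T} k" "mono_on {0..T} k"
    and g: "continuous_on {0..T} g" "\<And>s. s \<in> {0..T} \<Longrightarrow> 0 \<le> g s"
    and zero: "(LINT s:{0..T}|stieltjes_measure T k. g s) = 0"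
    and ab: "0 \<le> a" "a \<le> b" "b \<le> T" and pos: "\<And>s. a \<le> s \<Longrightarrow> s < b \<Longrightarrow> 0 < g s"
  shows "k b = k a"
proof -
  define k' where "k' s = k (max 0 (min s T))" for s
  let ?\<mu> = "interval_measure k'"
  have mono: "k' x \<le> k' y" if "x \<le> y" for x y
    unfolding k'_def using T that by (intro mono_onD[OF k(2)]) auto
  have cont: "continuous_on UNIV k'"
    unfolding k'_def using T
    by (intro continuous_on_compose2[OF k(1)] continuous_intros) auto
  then have right: "continuous (at_right x) k'" for x
    by (simp add: continuous_on_eq_continuous_at continuous_at_imp_continuous_within)
  note Ioc = emeasure_interval_measure_Ioc[OF _ mono right]
  have Icc: "emeasure ?\<mu> {0..T} = ennreal (k' T - k' 0)"
    using T cont by (intro emeasure_interval_measure_Icc mono) auto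
  have sg: "set_borel_measurable ?\<mu> {0..T} g"
    using borel_measurable_continuous_on_indicator[OF _ g(1)]
    by (simp add: set_borel_measurable_def cong: measurable_cong_sets)
  have "bounded (g ` {0..T})"
    by (intro compact_imp_bounded compact_continuous_image g(1)) simp
  then obtain B where B: "\<And>s. s \<in> {0..T} \<Longrightarrow> \<bar>g s\<bar> \<le> B"
    unfolding bounded_real by blast
  \<comment> \<open>Needed before the zero integral says anything: the Bochner integral of a
    non-integrable function is 0 as well.\<close>
  have int: "integrable ?\<mu> (\<lambda>s. indicator {0..T} s * g s)"
  proof (rule Bochner_Integration.integrable_bound[where f="\<lambda>s. indicator {0..T} s * B"])
    show "integrable ?\<mu> (\<lambda>s. indicator {0..T} s * B)"
      using Icc by (intro integrable_mult_left) (simp add: integrable_indicator_iff)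
    show "AE s in ?\<mu>. norm (indicator {0..T} s * g s) \<le> norm (indicator {0..T} s * B)"
      using B by (intro AE_I2) (force simp: indicator_def)
  qed (use sg in \<open>simp add: set_borel_measurable_def\<close>)
  have "AE s in ?\<mu>. indicator {0..T} s * g s = 0"
    using zero int g(2)
    by (subst integral_nonneg_eq_0_iff_AE[symmetric])
      (auto simp: set_lebesgue_integral_def stieltjes_measure_def k'_def[abs_def] indicator_def)
  then have AE0: "AE s in ?\<mu>. s \<notin> {a..<b}"
  proof eventually_elim
    case (elim s)
    show ?case
    proof
      assume "s \<in> {a..<b}"
      then show False using elim pos[of s] ab by simp
    qed
  qed
  have flat: "k' c = k' a" if "a \<le> c" "c < b" for c
  proof -
    have "AE s in ?\<mu>. s \<notin> {a<..c}"
      using AE0 that by (auto elim!: eventually_mono)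
    then have "emeasure ?\<mu> {a<..c} = 0"
      by (subst (asm) AE_iff_measurable[of "{a<..c}"]) auto
    then show ?thesis
      using Ioc[OF that(1)] mono[OF that(1)] by (simp add: ennreal_eq_0_iff)
  qed
  have "k' b = k' a"
  proof (cases "a < b")
    case True
    have "isCont k' b"
      using cont by (simp add: continuous_on_eq_continuous_at)
    then have "(k' \<longlongrightarrow> k' b) (at_left b)"
      unfolding isCont_def by (rule tendsto_within_subset) simp
    moreover have "(k' \<longlongrightarrow> k' a) (at_left b)"
    proof (rule tendsto_eventually)
      show "\<forall>\<^sub>F c in at_left b. k' c = k' a"
        unfolding eventually_at_left[OF True] using True by (auto intro!: exI[of _ a] flat)
    qed
    ultimately show ?thesis
      by (intro tendsto_unique[of "at_left b"]) auto
  qed (use ab in auto)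
  then show ?thesis using ab by (simp add: k'_def)
qed

section \<open>Joint measurability of predictable processes and of composed functions\<close>

lemma space_predictable_sigma [simp]: "space (predictable_sigma F T) = space (F 0) \<times> {0..T}"
  by (simp add: predictable_sigma_def space_measure_of_conv)

context complete_filtration
begin

abbreviation (input) prod_measure :: "real \<Rightarrow> ('a \<times> real) measure" where
  "prod_measure T \<equiv> P \<Otimes>\<^sub>M time_measure T"

lemma sets_time_measure: "A \<in> sets borel \<Longrightarrow> A \<subseteq> {0..T} \<Longrightarrow> A \<in> sets (time_measure T)"
  by (auto simp: sets_restrict_space)

text \<open>The generators of the predictable sigma-algebra are measurable rectangles of the
  product; \<open>0 \<le> T\<close> places the slice at time 0 inside the interval.\<close>

lemma predictable_measurable:
  fixes X :: "real \<Rightarrow> 'a \<Rightarrow> 'b::topological_space"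
  assumes "predictable F T X" "0 \<le> T"
  shows "(\<lambda>(\<omega>, t). X t \<omega>) \<in> borel_measurable (prod_measure T)"
proof -
  let ?G = "{A \<times> {0} |A. A \<in> sets (F 0)} \<union>
    {A \<times> {s<..t} |A s t. 0 \<le> s \<and> s \<le> t \<and> t \<le> T \<and> A \<in> sets (F s)}"
  have sp: "space (prod_measure T) = space (F 0) \<times> {0..T}"
    by (simp add: space_pair_measure space_restrict_space)
  have sub: "?G \<subseteq> sets (prod_measure T)"
    using assms(2) by (auto intro!: sets_time_measure sets_F_P)
  then have "?G \<subseteq> Pow (space (F 0) \<times> {0..T})"
    using sets.space_closed[of "prod_measure T"] unfolding sp by (rule order_trans)
  then have "sets (predictable_sigma F T) = sigma_sets (space (F 0) \<times> {0..T}) ?G"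
    unfolding predictable_sigma_def by (rule sets_measure_of)
  also have "\<dots> \<subseteq> sets (prod_measure T)"
    using sets.sigma_sets_subset[OF sub] unfolding sp .
  finally have le: "sets (predictable_sigma F T) \<subseteq> sets (prod_measure T)" .
  show ?thesis
  proof (rule measurableI)
    fix B :: "'b set" assume "B \<in> sets borel"
    with assms(1) have "(\<lambda>(\<omega>, t). X t \<omega>) -` B \<inter> space (predictable_sigma F T) \<in> sets (predictable_sigma F T)"
      unfolding predictable_def by (rule measurable_sets)
    then show "(\<lambda>(\<omega>, t). X t \<omega>) -` B \<inter> space (prod_measure T) \<in> sets (prod_measure T)"
      using le unfolding sp space_predictable_sigma by (rule subsetD[rotated])
  qed simp
qed

end

text \<open>
  The composition need not be measurable itself, since \<open>g p\<close> is continuous for almost every \<open>p\<close>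
  only.
\<close>

lemma caratheodory_measurable_AE:
  fixes g :: "'p \<Rightarrow> 'e::{second_countable_topology, metric_space} \<Rightarrow> real"
  assumes g: "\<And>x. (\<lambda>p. g p x) \<in> borel_measurable N"
    and cont: "AE p in N. continuous_on UNIV (g p)" and X: "X \<in> borel_measurable N"
  obtains h where "h \<in> borel_measurable N" "AE p in N. g p (X p) = h p"
proof -
  \<comment> \<open>With a simple function in place of \<open>X\<close>, the composition takes
    finitely many second arguments and is measurable by pieces. Continuity of \<open>g p\<close>
    then identifies the limit for almost every \<open>p\<close>.\<close>
  obtain S where S: "\<And>i. simple_function N (S i)" "\<And>p. p \<in> space N \<Longrightarrow> (\<lambda>i. S i p) \<longlonglongrightarrow> X p"
    using borel_measurable_implies_sequence_metric[OF X] by metis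
  have gS: "(\<lambda>p. g p (S i p)) \<in> borel_measurable N" for i
  proof (rule measurable_compose_countable'[where I="S i ` space N" and g="S i" and f="\<lambda>x p. g p x"])
    show "S i \<in> measurable N (count_space (S i ` space N))"
      using S(1)[of i] by (auto simp: simple_function_def measurable_count_space_eq2)
    show "countable (S i ` space N)"
      using S(1)[of i] by (simp add: simple_function_def uncountable_infinite countable_finite)
  qed (rule g)
  show thesis
  proof
    show "(\<lambda>p. lim (\<lambda>i. g p (S i p))) \<in> borel_measurable N"
      using gS by measurable
    show "AE p in N. g p (X p) = lim (\<lambda>i. g p (S i p))"
      using cont AE_space
    proof eventually_elim
      case (elim p)
      have "(\<lambda>i. g p (S i p)) \<longlonglongrightarrow> g p (X p)"
        by (rule continuous_on_tendsto_compose[OF elim(1) S(2)[OF elim(2)]]) auto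
      then show ?case by (rule limI[symmetric])
    qed
  qed
qed

lemma Sinf_norm_bounded:
  assumes "Sinf_norm P T X < \<infinity>"
  obtains B where "0 \<le> B" "AE \<omega> in P. \<forall>t\<in>{0..T}. norm (X t \<omega>) \<le> B"
proof
  have "AE \<omega> in P. (SUP t\<in>{0..T}. ennreal (norm (X t \<omega>))) \<le> Sinf_norm P T X"
    unfolding Sinf_norm_def by (rule esssup_AE)
  then show "AE \<omega> in P. \<forall>t\<in>{0..T}. norm (X t \<omega>) \<le> enn2real (Sinf_norm P T X)"
  proof eventually_elim
    case (elim \<omega>)
    show ?case
    proof
      fix t assume "t \<in> {0..T}"
      then have "ennreal (norm (X t \<omega>)) \<le> Sinf_norm P T X"
        using elim by (meson SUP_upper order_trans)
      then show "norm (X t \<omega>) \<le> enn2real (Sinf_norm P T X)"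
        using assms by (cases "Sinf_norm P T X") (auto simp: ennreal_le_iff)
    qed
  qed
qed simp

section \<open>Pathwise time integrals of the generator\<close>

lemma sigma_finite_time_measure: "sigma_finite_measure (time_measure T)"
  by (rule sigma_finite_measure_restrict_space) (auto intro: sigma_finite_lborel)

text \<open>\<open>\<gamma>\<close> is only Lebesgue measurable, \<open>q\<close> is Borel. They are
  interchangeable under \<open>lebesgue\<close>, and for Borel integrands completion does not change
  the integral. The right-hand side is the form to which measurability of parameter integrals
  applies.\<close>

lemma integral_lebesgue_eq_time_measure:
  fixes \<gamma> q :: "real \<Rightarrow> real"
  assumes q: "q \<in> borel_measurable (time_measure T)"
    and eq: "AE s in time_measure T. \<gamma> s = q s"
    and fin: "(\<integral>\<^sup>+s. ennreal \<bar>q s\<bar> \<partial>time_measure T) < \<infinity>"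
  shows "set_integrable lebesgue {0..T} \<gamma>"
    and "0 \<le> a \<Longrightarrow> b \<le> T \<Longrightarrow>
      (LINT s:{a..b}|lebesgue. \<gamma> s) = (LINT s|time_measure T. indicator {a..b} s * q s)"
proof -
  have sets: "{0..T} \<inter> space lborel \<in> sets lborel" by simp
  have intq: "integrable (time_measure T) q"
    using q fin by (intro integrableI_bounded) auto
  have q': "(\<lambda>s. indicator {0..T} s * q s) \<in> borel_measurable lborel"
    using q by (subst (asm) borel_measurable_restrict_space_iff[OF sets]) simp
  have "AE s in lborel. s \<in> {0..T} \<longrightarrow> \<gamma> s = q s"
    using eq by (subst (asm) AE_restrict_space_iff[OF sets]) simp
  then have eq': "AE s in lebesgue. s \<in> {0..T} \<longrightarrow> \<gamma> s = q s"
    by (rule AE_completion)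
  have int': "integrable lebesgue (\<lambda>s. indicator {0..T} s * q s)"
    using intq q' by (subst integrable_completion) (auto simp: integrable_restrict_space[OF sets])
  have meas: "(\<lambda>s. indicator {0..T} s * \<gamma> s) \<in> borel_measurable lebesgue"
    using eq' by (intro complete_measure.borel_measurable_cong_AE[OF completion.complete_measure_axioms measurable_completion[OF q']])
      (auto elim!: eventually_mono simp: indicator_def)
  have "integrable lebesgue (\<lambda>s. indicator {0..T} s * \<gamma> s)"
    using eq' by (intro Bochner_Integration.integrable_cong_AE_imp[OF int' meas])
      (auto elim!: eventually_mono simp: indicator_def)
  then show "set_integrable lebesgue {0..T} \<gamma>"
    by (simp add: set_integrable_def)
  assume ab: "0 \<le> a" "b \<le> T"
  \<comment> \<open>The agreement of \<open>\<gamma>\<close> with \<open>q\<close> is known on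
    \<open>{0..T}\<close> only, so that indicator is inserted first.\<close>
  have ind: "indicator {a..b} s * x = indicator {a..b} s * (indicator {0..T} s * x)" for s and x :: real
    using ab by (auto simp: indicator_def)
  have "(LINT s:{a..b}|lebesgue. \<gamma> s) = (LINT s|lebesgue. indicator {a..b} s * (indicator {0..T} s * \<gamma> s))"
    by (simp add: set_lebesgue_integral_def ind[symmetric])
  also have "\<dots> = (LINT s|lebesgue. indicator {a..b} s * (indicator {0..T} s * q s))"
  proof (rule integral_cong_AE)
    show "(\<lambda>s. indicator {a..b} s * (indicator {0..T} s * \<gamma> s)) \<in> borel_measurable lebesgue"
      by (intro borel_measurable_times meas borel_measurable_indicator) simp
    show "(\<lambda>s. indicator {a..b} s * (indicator {0..T} s * q s)) \<in> borel_measurable lebesgue"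
      by (intro borel_measurable_times measurable_completion[OF q'] borel_measurable_indicator) simp
    show "AE s in lebesgue. indicator {a..b} s * (indicator {0..T} s * \<gamma> s) = indicator {a..b} s * (indicator {0..T} s * q s)"
      using eq' by eventually_elim (auto simp: indicator_def)
  qed
  also have "\<dots> = (LINT s|lborel. indicator {a..b} s * (indicator {0..T} s * q s))"
    by (intro integral_completion borel_measurable_times q' borel_measurable_indicator) simp
  also have "\<dots> = (LINT s|lborel. indicator {0..T} s *\<^sub>R (indicator {a..b} s * q s))"
    by (intro Bochner_Integration.integral_cong) auto
  also have "\<dots> = (LINT s|time_measure T. indicator {a..b} s * q s)"
    by (rule integral_restrict_space[OF sets, symmetric])
  finally show "(LINT s:{a..b}|lebesgue. \<gamma> s) = (LINT s|time_measure T. indicator {a..b} s * q s)" .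
qed

context complete_filtration
begin

text \<open>Along a path a simple process is bounded in time. If the integral of the squared norm of
  \<open>H\<close> were infinite there, the distance to every approximating simple process would be
  infinite too; convergence in probability leaves measure zero for such paths.\<close>

lemma ito_integrand_square_integrable:
  assumes ito: "is_ito_integral P F T W H I" and T: "0 \<le> T"
  shows "AE \<omega> in P. (\<integral>\<^sup>+t. ennreal ((norm (H t \<omega>))\<^sup>2) \<partial>time_measure T) < \<infinity>"
proof -
  interpret time: sigma_finite_measure "time_measure T" by (rule sigma_finite_time_measure)
  obtain m \<tau> h where simple: "\<And>k. simple_integrand P F T (m k) (\<tau> k) (h k)"
    and conv: "to_zero_in_prob P (\<lambda>k \<omega>.
          \<integral>\<^sup>+t\<in>{0..T}. ennreal ((norm (simple_process (m k) (\<tau> k) (h k) t \<omega> - H t \<omega>))\<^sup>2) \<partial>lborel)"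
    using ito unfolding is_ito_integral_def by blast
  define V where "V k t \<omega> = simple_process (m k) (\<tau> k) (h k) t \<omega>" for k t \<omega>
  define D where "D k \<omega> = (\<integral>\<^sup>+t. ennreal ((norm (V k t \<omega> - H t \<omega>))\<^sup>2) \<partial>time_measure T)" for k \<omega>
  define J where "J \<omega> = (\<integral>\<^sup>+t. ennreal ((norm (H t \<omega>))\<^sup>2) \<partial>time_measure T)" for \<omega>
  have H [measurable]: "(\<lambda>(\<omega>, t). H t \<omega>) \<in> borel_measurable (prod_measure T)"
    using ito T by (intro predictable_measurable) (auto simp: is_ito_integral_def)
  have V: "(\<lambda>(\<omega>, t). V k t \<omega>) \<in> borel_measurable (prod_measure T)" for k
  proof -
    have h: "h k j \<in> borel_measurable P" if "j < m k" for j
      using simple[of k] that by (auto simp: simple_integrand_def intro: measurable_F_P)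
    have "(\<lambda>p. \<Sum>j<m k. indicator {\<tau> k j<..\<tau> k (Suc j)} (snd p) *\<^sub>R h k j (fst p)) \<in> borel_measurable (prod_measure T)"
    proof (intro borel_measurable_sum borel_measurable_scaleR)
      fix j assume "j \<in> {..<m k}"
      then show "(\<lambda>p. h k j (fst p)) \<in> borel_measurable (prod_measure T)"
        using h by (intro measurable_compose[OF measurable_fst]) auto
      have "indicator {\<tau> k j<..\<tau> k (Suc j)} \<in> borel_measurable (time_measure T)"
        by (intro measurable_restrict_space1) auto
      then show "(\<lambda>p. indicator {\<tau> k j<..\<tau> k (Suc j)} (snd p) :: real) \<in> borel_measurable (prod_measure T)"
        by (rule measurable_compose[OF measurable_snd])
    qed
    then show ?thesis by (simp add: V_def simple_process_def case_prod_beta')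
  qed
  note [measurable] = V
  have D_meas [measurable]: "D k \<in> borel_measurable P" for k
    unfolding D_def by measurable
  have J_meas [measurable]: "J \<in> borel_measurable P"
    unfolding J_def by measurable
  have D_eq: "(\<integral>\<^sup>+t\<in>{0..T}. ennreal ((norm (simple_process (m k) (\<tau> k) (h k) t \<omega> - H t \<omega>))\<^sup>2) \<partial>lborel) = D k \<omega>" for k \<omega>
    unfolding D_def V_def by (simp add: nn_integral_restrict_space)
  have sub: "D k \<omega> = \<infinity>" if J: "J \<omega> = \<infinity>" and \<omega>: "\<omega> \<in> space P" for k \<omega>
  proof (rule ccontr)
    assume fin: "D k \<omega> \<noteq> \<infinity>"
    \<comment> \<open>A bound for this one path, free to depend on \<open>\<omega>\<close>; it is
      integrable over the finite time interval.\<close>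
    define B where "B = (\<Sum>j<m k. norm (h k j \<omega>))"
    have VB: "norm (V k t \<omega>) \<le> B" for t
      unfolding V_def simple_process_def B_def
      by (intro sum_norm_le) (auto simp: indicator_def)
    have [measurable]: "(\<lambda>t. V k t \<omega>) \<in> borel_measurable (time_measure T)" "(\<lambda>t. H t \<omega>) \<in> borel_measurable (time_measure T)"
      using measurable_Pair2[OF V \<omega>] measurable_Pair2[OF H \<omega>] by simp_all
    have "J \<omega> \<le> (\<integral>\<^sup>+t. 2 * ennreal ((norm (V k t \<omega> - H t \<omega>))\<^sup>2) + ennreal (2 * B\<^sup>2) \<partial>time_measure T)"
      unfolding J_def
    proof (intro nn_integral_mono)
      fix t
      have "norm (H t \<omega>) \<le> norm (V k t \<omega> - H t \<omega>) + B"
        using norm_triangle_ineq4[of "V k t \<omega>" "V k t \<omega> - H t \<omega>"] VB[of t] by simp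
      then have "(norm (H t \<omega>))\<^sup>2 \<le> (norm (V k t \<omega> - H t \<omega>) + B)\<^sup>2"
        by (intro power_mono) auto
      also have "\<dots> \<le> 2 * (norm (V k t \<omega> - H t \<omega>))\<^sup>2 + 2 * B\<^sup>2"
        using sum_squares_bound[of "norm (V k t \<omega> - H t \<omega>)" B] by (simp add: power2_sum)
      finally have "ennreal ((norm (H t \<omega>))\<^sup>2) \<le> ennreal (2 * (norm (V k t \<omega> - H t \<omega>))\<^sup>2 + 2 * B\<^sup>2)"
        by (rule ennreal_leI)
      then show "ennreal ((norm (H t \<omega>))\<^sup>2) \<le> 2 * ennreal ((norm (V k t \<omega> - H t \<omega>))\<^sup>2) + ennreal (2 * B\<^sup>2)"
        by (simp add: ennreal_plus ennreal_mult)
    qed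
    also have "\<dots> = 2 * D k \<omega> + ennreal (2 * B\<^sup>2) * emeasure lborel {0..T}"
      unfolding D_def by (simp add: nn_integral_add nn_integral_cmult emeasure_restrict_space space_restrict_space)
    also have "\<dots> < \<infinity>"
      using fin T by (auto simp: ennreal_mult_less_top less_top)
    finally show False using J by simp
  qed
  \<comment> \<open>The level 1 is arbitrary: an infinite distance exceeds every level.\<close>
  have "measure P {\<omega>\<in>space P. J \<omega> = \<infinity>} \<le> 0"
  proof (rule LIMSEQ_le_const)
    show "(\<lambda>k. measure P {\<omega>\<in>space P. D k \<omega> > ennreal 1}) \<longlonglongrightarrow> 0"
      using conv unfolding to_zero_in_prob_def D_eq by (meson zero_less_one)
    show "\<exists>N. \<forall>k\<ge>N. measure P {\<omega>\<in>space P. J \<omega> = \<infinity>} \<le> measure P {\<omega>\<in>space P. D k \<omega> > ennreal 1}"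
      proof (intro exI[of _ 0] allI impI finite_measure_mono subsetI)
      fix k \<omega> assume "\<omega> \<in> {\<omega>\<in>space P. J \<omega> = \<infinity>}"
      then show "\<omega> \<in> {\<omega>\<in>space P. D k \<omega> > ennreal 1}"
        using sub[of \<omega> k] by simp
    qed measurable
  qed
  then have "emeasure P {\<omega>\<in>space P. J \<omega> = \<infinity>} = 0"
    by (simp add: emeasure_eq_measure measure_le_0_iff)
  then have "AE \<omega> in P. J \<omega> \<noteq> \<infinity>"
    by (subst AE_iff_measurable[OF _ refl]) auto
  then show ?thesis by (auto simp: J_def less_top elim: eventually_mono)
qed

text \<open>With \<open>B\<close> bounding \<open>Y\<close>, the growth condition gives the
  integrable bound \<open>C * (1 + B)\<close> plus \<open>C\<close> times the squared norm of
  \<open>H\<close>. The function \<open>h\<close> is independent of the integration limits, which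
  later allows a random upper limit.\<close>

lemma generator_time_integrable:
  fixes f :: "'n::finite \<Rightarrow> 'a \<Rightarrow> real \<Rightarrow> real ^ 'n \<Rightarrow> real ^ 'd \<Rightarrow> real"
  assumes A1: "assumption_A1 P F T C f" and T: "0 \<le> T" and C: "0 \<le> C"
    and Y: "Y \<in> Sinf_space P F T" and ito: "is_ito_integral P F T W H I"
  obtains h where "h \<in> borel_measurable (prod_measure T)"
    "AE \<omega> in P. set_integrable lebesgue {0..T} (\<lambda>s. f i \<omega> s (Y s \<omega>) (H s \<omega>)) \<and>
      (\<forall>a b. 0 \<le> a \<and> b \<le> T \<longrightarrow> (LINT s:{a..b}|lebesgue. f i \<omega> s (Y s \<omega>) (H s \<omega>)) =
         (LINT s|time_measure T. indicator {a..b} s * h (\<omega>, s)))"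
proof -
  interpret time: sigma_finite_measure "time_measure T" by (rule sigma_finite_time_measure)
  interpret pair: pair_sigma_finite P "time_measure T" ..
  have Hm: "(\<lambda>(\<omega>, t). H t \<omega>) \<in> borel_measurable (prod_measure T)"
    using ito T by (intro predictable_measurable) (auto simp: is_ito_integral_def)
  have Ym: "(\<lambda>(\<omega>, t). Y t \<omega>) \<in> borel_measurable (prod_measure T)"
    using Y T by (intro predictable_measurable) (auto simp: Sinf_space_def)
  obtain B where B: "0 \<le> B" "AE \<omega> in P. \<forall>t\<in>{0..T}. norm (Y t \<omega>) \<le> B"
    using Y Sinf_norm_bounded[of P T Y] by (auto simp: Sinf_space_def)
  have reg: "AE p in prod_measure T.
        (\<forall>y z. \<bar>f i (fst p) (snd p) y z\<bar> \<le> C * (1 + norm y + (norm z)\<^sup>2)) \<and>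
        (\<forall>y y' z z'. \<bar>f i (fst p) (snd p) y z - f i (fst p) (snd p) y' z'\<bar>
           \<le> C * norm (y - y') + C * (1 + norm z + norm z') * norm (z - z'))"
    using A1 unfolding assumption_A1_def by (simp add: case_prod_beta')
  \<comment> \<open>Both space variables are merged into one, so that the local Lipschitz estimate
    becomes continuity of \<open>g p\<close> for almost every \<open>p\<close>.\<close>
  define g where "g p x = f i (fst p) (snd p) (fst x) (snd x)" for p x
  have gm: "(\<lambda>p. g p x) \<in> borel_measurable (prod_measure T)" for x
    using A1 unfolding assumption_A1_def g_def by (simp add: case_prod_beta')
  have gc: "AE p in prod_measure T. continuous_on UNIV (g p)"
    using reg
  proof eventually_elim
    case (elim p)
    have "(g p \<longlongrightarrow> g p x0) (at x0)" for x0
    proof (rule LIM_zero_cancel, rule Lim_null_comparison)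
      show "\<forall>\<^sub>F x in at x0. norm (g p x - g p x0) \<le> C * norm (fst x - fst x0) +
          C * (1 + norm (snd x) + norm (snd x0)) * norm (snd x - snd x0)"
        using elim unfolding g_def by (intro always_eventually) auto
      show "((\<lambda>x. C * norm (fst x - fst x0) +
          C * (1 + norm (snd x) + norm (snd x0)) * norm (snd x - snd x0)) \<longlongrightarrow> 0) (at x0)"
        by (rule tendsto_eq_intros refl | simp)+
    qed
    then show ?case by (simp add: continuous_on_eq_continuous_at isCont_def)
  qed
  have "(\<lambda>p. (case p of (\<omega>, t) \<Rightarrow> Y t \<omega>, case p of (\<omega>, t) \<Rightarrow> H t \<omega>)) \<in> borel_measurable (prod_measure T)"
    using Ym Hm by (rule borel_measurable_Pair)
  from caratheodory_measurable_AE[OF gm gc this] obtain h where h: "h \<in> borel_measurable (prod_measure T)"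
    and gh: "AE p in prod_measure T. g p (case p of (\<omega>, t) \<Rightarrow> Y t \<omega>, case p of (\<omega>, t) \<Rightarrow> H t \<omega>) = h p"
    by blast
  \<comment> \<open>Fubini for null sets: almost every section of the exceptional set is null in
    time.\<close>
  have pw: "AE \<omega> in P. AE s in time_measure T. f i \<omega> s (Y s \<omega>) (H s \<omega>) = h (\<omega>, s)"
    using pair.AE_pair[OF gh] by (simp add: g_def)
  have gr: "AE \<omega> in P. AE s in time_measure T. \<forall>y z. \<bar>f i \<omega> s y z\<bar> \<le> C * (1 + norm y + (norm z)\<^sup>2)"
    using pair.AE_pair[OF reg] by (auto elim!: eventually_mono)
  show thesis
  proof (rule that[OF h])
    show "AE \<omega> in P. set_integrable lebesgue {0..T} (\<lambda>s. f i \<omega> s (Y s \<omega>) (H s \<omega>)) \<and>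
      (\<forall>a b. 0 \<le> a \<and> b \<le> T \<longrightarrow> (LINT s:{a..b}|lebesgue. f i \<omega> s (Y s \<omega>) (H s \<omega>)) =
         (LINT s|time_measure T. indicator {a..b} s * h (\<omega>, s)))"
      using pw gr B(2) ito_integrand_square_integrable[OF ito T] AE_space
    proof eventually_elim
      case (elim \<omega>)
      have q: "(\<lambda>s. h (\<omega>, s)) \<in> borel_measurable (time_measure T)"
        using measurable_Pair2[OF h elim(5)] .
      have Hq: "(\<lambda>t. H t \<omega>) \<in> borel_measurable (time_measure T)"
        using measurable_Pair2[OF Hm elim(5)] by simp
      have "AE s in time_measure T. \<bar>h (\<omega>, s)\<bar> \<le> C * (1 + B) + C * (norm (H s \<omega>))\<^sup>2"
        using elim(1,2) AE_space
      proof eventually_elim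
        case (elim s)
        then have "s \<in> {0..T}" by (simp add: space_restrict_space)
        then have "norm (Y s \<omega>) \<le> B" using \<open>\<forall>t\<in>{0..T}. norm (Y t \<omega>) \<le> B\<close> by blast
        then have "C * (1 + norm (Y s \<omega>) + (norm (H s \<omega>))\<^sup>2) \<le> C * (1 + B + (norm (H s \<omega>))\<^sup>2)"
          using C by (intro mult_left_mono) auto
        moreover have "\<bar>h (\<omega>, s)\<bar> \<le> C * (1 + norm (Y s \<omega>) + (norm (H s \<omega>))\<^sup>2)"
          using elim(1,2) by metis
        ultimately show ?case by (simp add: algebra_simps)
      qed
      then have "(\<integral>\<^sup>+s. ennreal \<bar>h (\<omega>, s)\<bar> \<partial>time_measure T) \<le>
          (\<integral>\<^sup>+s. ennreal (C * (1 + B)) + ennreal C * ennreal ((norm (H s \<omega>))\<^sup>2) \<partial>time_measure T)"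
        using B(1) C by (intro nn_integral_mono_AE)
          (auto elim!: eventually_mono simp: ennreal_mult[symmetric] ennreal_plus[symmetric] simp del: ennreal_plus intro!: ennreal_leI)
      also have "\<dots> = ennreal (C * (1 + B)) * emeasure lborel {0..T} +
          ennreal C * (\<integral>\<^sup>+s. ennreal ((norm (H s \<omega>))\<^sup>2) \<partial>time_measure T)"
        using Hq by (simp add: nn_integral_add nn_integral_cmult emeasure_restrict_space space_restrict_space)
      also have "\<dots> < \<infinity>"
        using elim(4) T by (auto simp: ennreal_mult_less_top)
      finally have fin: "(\<integral>\<^sup>+s. ennreal \<bar>h (\<omega>, s)\<bar> \<partial>time_measure T) < \<infinity>" .
      show ?case
        using integral_lebesgue_eq_time_measure[OF q elim(1) fin] by blast
    qed
  qed
qed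

end

section \<open>The optimal stopping time\<close>

text \<open>Inserting \<open>T\<close> makes the value \<open>T\<close> when there is no zero.\<close>

definition first_zero :: "real \<Rightarrow> real \<Rightarrow> (real \<Rightarrow> real) \<Rightarrow> real" where
  "first_zero t T x = Inf (insert T {s\<in>{t..T}. x s = 0})"

lemma bdd_below_zeros: "bdd_below (insert T {s\<in>{t..T}. x s = 0})" for t T :: real
  by (rule bdd_belowI[of _ "min t T"]) auto

lemma first_zero_bounds:
  assumes "t \<le> T" shows "t \<le> first_zero t T x" "first_zero t T x \<le> T"
  using assms unfolding first_zero_def
  by (auto intro!: cInf_greatest cInf_lower bdd_below_zeros)

lemma first_zero_lower: "s \<in> {t..T} \<Longrightarrow> x s = 0 \<Longrightarrow> first_zero t T x \<le> s"
  unfolding first_zero_def by (intro cInf_lower bdd_below_zeros) auto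

text \<open>The zero set of a continuous function is closed and stays so with \<open>T\<close>
  inserted, so the infimum is attained; below \<open>T\<close> it cannot be the inserted
  point.\<close>

lemma first_zero_zero:
  assumes "continuous_on {t..T} x" "t \<le> T" "first_zero t T x < T"
  shows "x (first_zero t T x) = 0"
proof -
  have "closed (insert T {s\<in>{t..T}. x s = 0})"
    using continuous_closed_preimage_constant[OF assms(1)] by (auto simp: closed_insert)
  then have "first_zero t T x \<in> insert T {s\<in>{t..T}. x s = 0}"
    unfolding first_zero_def by (intro closed_contains_Inf bdd_below_zeros) auto
  then show ?thesis using assms(3) by auto
qed

context complete_filtration
begin

text \<open>A nonnegative continuous path has a zero in \<open>{t..s}\<close> exactly when it takes
  arbitrarily small values on a countable dense subset \<open>D\<close> of that interval:
  compactness provides a minimum, which must then be 0, and continuity gives the converse. The event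
  \<open>A\<close> so described involves countably many values up to time \<open>s\<close>; it
  agrees with the hitting event on good paths, and the null sets in \<open>F s\<close> bridge the
  rest.\<close>

lemma first_zero_stopping_time:
  fixes X :: "real \<Rightarrow> 'a \<Rightarrow> real"
  assumes X: "adapted F T X" and cont: "AE \<omega> in P. continuous_on {0..T} (\<lambda>s. X s \<omega>)"
    and nonneg: "AE \<omega> in P. \<forall>s\<in>{0..T}. 0 \<le> X s \<omega>" and t: "t \<in> {0..T}"
  shows "(\<lambda>\<omega>. first_zero t T (\<lambda>s. X s \<omega>)) \<in> stopping_times_between P F t T"
proof -
  have tT: "t \<le> T" using t by simp
  note bounds = first_zero_bounds[OF tT]
  have "Measurable.pred (F s) (\<lambda>\<omega>. first_zero t T (\<lambda>s. X s \<omega>) \<le> s)" for s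
  proof -
    consider "s < t" | "T \<le> s" | "t \<le> s" "s < T" by linarith
    then show ?thesis
    proof cases
      case 1
      then have "(\<lambda>\<omega>. first_zero t T (\<lambda>s. X s \<omega>) \<le> s) = (\<lambda>_. False)"
        using less_le_trans[OF _ bounds(1)] by (simp add: fun_eq_iff not_le)
      then show ?thesis by simp
    next
      case 2
      then have "(\<lambda>\<omega>. first_zero t T (\<lambda>s. X s \<omega>) \<le> s) = (\<lambda>_. True)"
        using order_trans[OF bounds(2)] by (simp add: fun_eq_iff)
      then show ?thesis by simp
    next
      case 3
      obtain D where D: "countable D" "D \<subseteq> {t..s}" "{t..s} \<subseteq> closure D"
        using separable[of "{t..s}"] by metis
      define A where "A = {\<omega>\<in>space P. \<forall>n. \<exists>q\<in>D. X q \<omega> < inverse (real (Suc n))}"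
      have XD: "X q \<in> borel_measurable (F s)" if "q \<in> D" for q
      proof -
        have "q \<in> {0..T}" "q \<le> s" using D(2) that t 3 by auto
        then show ?thesis
          using X measurable_F_mono[of "X q" q borel s] by (auto simp: adapted_def)
      qed
      have "{\<omega>\<in>space P. X q \<omega> < inverse (real (Suc n))} \<in> sets (F s)" if "q \<in> D" for q n
        using borel_measurable_less[OF XD[OF that] borel_measurable_const, of "inverse (real (Suc n))"]
        by simp
      then have "(\<Inter>n. \<Union>q\<in>D. {\<omega>\<in>space P. X q \<omega> < inverse (real (Suc n))}) \<in> sets (F s)"
        using D(1) by (intro sets.countable_INT image_subsetI sets.countable_UN'') simp_all
      also have "(\<Inter>n. \<Union>q\<in>D. {\<omega>\<in>space P. X q \<omega> < inverse (real (Suc n))}) = A"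
        by (auto simp: A_def)
      finally have A: "A \<in> sets (F s)" .
      have "{\<omega>\<in>space P. first_zero t T (\<lambda>s. X s \<omega>) \<le> s} \<in> sets (F s)"
      proof (rule sets_F_cong_AE[OF A])
        show "AE \<omega> in P. \<omega> \<in> A \<longleftrightarrow> \<omega> \<in> {\<omega>\<in>space P. first_zero t T (\<lambda>s. X s \<omega>) \<le> s}"
          using cont nonneg AE_space
        proof eventually_elim
          case (elim \<omega>)
          let ?x = "\<lambda>s. X s \<omega>"
          have cs: "continuous_on {t..s} ?x" "continuous_on {t..T} ?x"
            using elim(1) t 3 by (auto intro: continuous_on_subset)
          show ?case
          proof
            assume "\<omega> \<in> A"
            then have small: "\<exists>q\<in>D. ?x q < inverse (real (Suc n))" for n by (simp add: A_def)
            obtain u where u: "u \<in> {t..s}" "\<And>v. v \<in> {t..s} \<Longrightarrow> ?x u \<le> ?x v"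
              using continuous_attains_inf[OF _ _ cs(1)] 3 by auto
            have "?x u \<le> inverse (real (Suc n))" for n
            proof -
              obtain q where "q \<in> D" "?x q < inverse (real (Suc n))" using small by blast
              then show ?thesis using u(2)[of q] D(2) by auto
            qed
            then have "?x u \<le> 0"
              by (intro LIMSEQ_le_const[OF LIMSEQ_inverse_real_of_nat]) blast
            moreover have "0 \<le> ?x u" using elim(2) u(1) t 3 by auto
            ultimately have "first_zero t T ?x \<le> u"
              using u(1) 3 by (intro first_zero_lower) auto
            then show "\<omega> \<in> {\<omega>\<in>space P. first_zero t T (\<lambda>s. X s \<omega>) \<le> s}"
              using u(1) elim(3) by simp
          next
            let ?u = "first_zero t T ?x"
            assume "\<omega> \<in> {\<omega>\<in>space P. first_zero t T (\<lambda>s. X s \<omega>) \<le> s}"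
            then have us: "?u \<le> s" by simp
            then have x0: "?x ?u = 0" using first_zero_zero[OF cs(2) tT] 3 by simp
            have ut: "?u \<in> {t..s}" using us bounds(1) by simp
            then obtain d where d: "\<And>n. d n \<in> D" "d \<longlonglongrightarrow> ?u"
              using D(3) closure_sequential[of ?u D] by blast
            have "d n \<in> {t..s}" for n using d(1) D(2) by blast
            then have lim: "(\<lambda>n. ?x (d n)) \<longlonglongrightarrow> 0"
              using continuous_on_tendsto_compose[OF cs(1) d(2) ut] x0 by simp
            have "\<exists>q\<in>D. ?x q < inverse (real (Suc n))" for n
            proof -
              have "\<forall>\<^sub>F j in sequentially. ?x (d j) < inverse (real (Suc n))"
                by (rule order_tendstoD) (use lim in auto)
              then obtain j where "?x (d j) < inverse (real (Suc n))"
                by (auto simp: eventually_sequentially)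
              then show ?thesis using d(1) by blast
            qed
            then show "\<omega> \<in> A" using elim(3) by (simp add: A_def)
          qed
        qed
      qed simp
      then show ?thesis by (simp add: pred_def)
    qed
  qed
  then show ?thesis
    by (simp add: stopping_times_between_def stopping_time_def bounds)
qed

end

section \<open>The augmented Brownian filtration as a complete filtration\<close>

lemma complete_filtration_augmented:
  fixes W :: "real \<Rightarrow> 'a \<Rightarrow> real ^ 'd"
  assumes W: "brownian_motion M T W"
  shows "complete_filtration (completion M) (augmented_filtration M T W)"
proof -
  interpret M: prob_space M using W by (simp add: brownian_motion_def)
  interpret P: prob_space "completion M"
    by (rule prob_spaceI) (simp add: M.emeasure_space_1)
  define R where "R u = (\<Union>s\<in>{0..u}. {W s -` B \<inter> space M | B. B \<in> sets borel})" for u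
  define G where "G s = sets (natural_filtration M W (min s T)) \<union> null_sets (completion M)" for s
  have RP: "R u \<subseteq> Pow (space M)" for u by (auto simp: R_def)
  have nat: "sets (natural_filtration M W u) = sigma_sets (space M) (R u)" for u
    unfolding natural_filtration_def R_def[symmetric] using RP by (rule sets_measure_of)
  \<comment> \<open>The cap at \<open>T\<close> matters: \<open>W\<close> is assumed measurable on
    \<open>{0..T}\<close> only.\<close>
  have R_M: "R (min s T) \<subseteq> sets M" for s
    using W by (auto simp: R_def brownian_motion_def intro: measurable_sets)
  have G_P: "G s \<subseteq> sets (completion M)" for s
    using sets.sigma_sets_subset[OF R_M[of s]] by (auto simp: G_def nat)
  have G_Pow: "G s \<subseteq> Pow (space M)" for s
    using G_P[of s] sets.space_closed[of "completion M"] by auto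
  have sets_F: "sets (augmented_filtration M T W s) = sigma_sets (space M) (G s)" for s
    unfolding augmented_filtration_def G_def[symmetric] using G_Pow by (rule sets_measure_of)
  have space_F: "space (augmented_filtration M T W s) = space M" for s
    unfolding augmented_filtration_def by (simp add: space_measure_of_conv)
  have G_mono: "G s \<subseteq> G t" if "s \<le> t" for s t
  proof -
    have "R (min s T) \<subseteq> R (min t T)" using that unfolding R_def by (intro UN_mono) auto
    then show ?thesis unfolding G_def nat by (intro Un_mono sigma_sets_mono') auto
  qed
  show ?thesis
  proof
    show "subalgebra (completion M) (augmented_filtration M T W s)" for s
      using sets.sigma_sets_subset[OF G_P[of s]] by (simp add: subalgebra_def space_F sets_F)
    show "sets (augmented_filtration M T W s) \<subseteq> sets (augmented_filtration M T W t)" if "s \<le> t" for s t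
      unfolding sets_F by (rule sigma_sets_mono'[OF G_mono[OF that]])
    show "A \<in> sets (augmented_filtration M T W s)" if "N \<in> null_sets (completion M)" "A \<subseteq> N" for N A s
      using null_sets_completion_subset[OF that(2,1)] unfolding sets_F G_def by blast
  qed
qed

section \<open>Path regularity of time integrals and measurability of stopped processes\<close>

lemma set_integral_lebesgue_tail:
  fixes \<gamma> :: "real \<Rightarrow> real"
  assumes int: "set_integrable lebesgue {0..T} \<gamma>"
  shows "continuous_on {0..T} (\<lambda>s. LINT u:{s..T}|lebesgue. \<gamma> u)"
    and "0 \<le> a \<Longrightarrow> a \<le> b \<Longrightarrow> b \<le> T \<Longrightarrow>
      (LINT u:{a..T}|lebesgue. \<gamma> u) = (LINT u:{a..b}|lebesgue. \<gamma> u) + (LINT u:{b..T}|lebesgue. \<gamma> u)"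
proof -
  have sub: "set_integrable lebesgue {a..b} \<gamma>" if "0 \<le> a" "b \<le> T" for a b
    using that by (intro set_integrable_subset[OF int]) auto
  note eq = set_lebesgue_integral_eq_integral[OF sub]
  \<comment> \<open>Both claims are transferred from the gauge integral, with which the Lebesgue
    integral agrees for integrable \<open>\<gamma>\<close>.\<close>
  show "continuous_on {0..T} (\<lambda>s. LINT u:{s..T}|lebesgue. \<gamma> u)"
    using indefinite_integral_continuous_1'[OF set_lebesgue_integral_eq_integral(1)[OF int]]
    by (rule continuous_on_eq) (simp add: eq(2))
  show "(LINT u:{a..T}|lebesgue. \<gamma> u) = (LINT u:{a..b}|lebesgue. \<gamma> u) + (LINT u:{b..T}|lebesgue. \<gamma> u)"
    if "0 \<le> a" "a \<le> b" "b \<le> T"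
    using Henstock_Kurzweil_Integration.integral_combine[of a b T \<gamma>] eq(1)[of a T] that
      eq(2)[of a T] eq(2)[of a b] eq(2)[of b T] by simp
qed

lemma set_integral_lebesgue_point:
  fixes \<gamma> :: "real \<Rightarrow> real"
  shows "(LINT u:{a}|lebesgue. \<gamma> u) = 0"
proof -
  have "AE u in lebesgue. indicator {a} u *\<^sub>R \<gamma> u = 0"
    using AE_completion[OF AE_lborel_singleton[of a]] by eventually_elim simp
  then show ?thesis
    unfolding set_lebesgue_integral_def by (rule integral_eq_zero_AE)
qed

context complete_filtration
begin

text \<open>The random upper limit is moved into the integrand as the indicator of the
  product-measurable region between \<open>t\<close> and \<open>\<nu> \<omega>\<close>; what remains
  is a parameter integral.\<close>

lemma time_integral_stopped_measurable:
  assumes h: "h \<in> borel_measurable (prod_measure T)" and \<nu>: "\<nu> \<in> borel_measurable P"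
  shows "(\<lambda>\<omega>. LINT s|time_measure T. indicator {t..\<nu> \<omega>} s * (h (\<omega>, s) :: real)) \<in> borel_measurable P"
proof -
  interpret time: sigma_finite_measure "time_measure T" by (rule sigma_finite_time_measure)
  have s: "snd \<in> borel_measurable (prod_measure T)"
    using measurable_compose[OF measurable_snd, of "\<lambda>x. x" "time_measure T" borel P]
    by (simp add: measurable_restrict_space1 measurable_ident_sets)
  have n: "(\<lambda>p. \<nu> (fst p)) \<in> borel_measurable (prod_measure T)"
    using \<nu> by (rule measurable_compose[OF measurable_fst])
  have "{p \<in> space (prod_measure T). t \<le> snd p \<and> snd p \<le> \<nu> (fst p)} \<in> sets (prod_measure T)"
    by (intro sets.sets_Collect_conj borel_measurable_le borel_measurable_const s n)
  then have "(\<lambda>p. indicator {p \<in> space (prod_measure T). t \<le> snd p \<and> snd p \<le> \<nu> (fst p)} p * h p) \<in> borel_measurable (prod_measure T)"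
    using h by (intro borel_measurable_times borel_measurable_indicator)
  then have "(\<lambda>(\<omega>, s). indicator {t..\<nu> \<omega>} s * h (\<omega>, s)) \<in> borel_measurable (prod_measure T)"
    by (rule measurable_cong[THEN iffD1, rotated]) (clarsimp simp: indicator_def)
  then show ?thesis
    by (rule time.borel_measurable_lebesgue_integral)
qed

lemma progressively_measurable_stopped:
  fixes X :: "real \<Rightarrow> 'a \<Rightarrow> 'b::topological_space"
  assumes X: "progressively_measurable F T X" and T: "0 \<le> T"
    and \<nu>: "\<nu> \<in> borel_measurable P" "\<And>\<omega>. \<omega> \<in> space P \<Longrightarrow> \<nu> \<omega> \<in> {0..T}"
  shows "(\<lambda>\<omega>. X (\<nu> \<omega>) \<omega>) \<in> borel_measurable P"
proof -
  have "(\<lambda>\<omega>. (\<omega>, \<nu> \<omega>)) \<in> P \<rightarrow>\<^sub>M F T \<Otimes>\<^sub>M restrict_space borel {0..T}"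
  proof (rule measurable_Pair)
    show "(\<lambda>\<omega>. \<omega>) \<in> P \<rightarrow>\<^sub>M F T" by (rule measurable_F_P[of _ T]) simp
    show "\<nu> \<in> P \<rightarrow>\<^sub>M restrict_space borel {0..T}"
      using \<nu> by (intro measurable_restrict_space2) auto
  qed
  moreover have "(\<lambda>(\<omega>, s). X s \<omega>) \<in> borel_measurable (F T \<Otimes>\<^sub>M restrict_space borel {0..T})"
    using X T by (simp add: progressively_measurable_def)
  ultimately have "(\<lambda>\<omega>. (\<lambda>(\<omega>, s). X s \<omega>) (\<omega>, \<nu> \<omega>)) \<in> borel_measurable P"
    by (rule measurable_compose)
  then show ?thesis by simp
qed

lemma progressively_measurable_adapted:
  fixes X :: "real \<Rightarrow> 'a \<Rightarrow> 'b::topological_space"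
  assumes X: "progressively_measurable F T X"
  shows "adapted F T X"
  unfolding adapted_def
proof
  fix u assume u: "u \<in> {0..T}"
  have "(\<lambda>\<omega>. (\<omega>, u)) \<in> F u \<rightarrow>\<^sub>M F u \<Otimes>\<^sub>M restrict_space borel {0..u}"
    using u by (intro measurable_Pair2') (simp add: space_restrict_space)
  moreover have "(\<lambda>(\<omega>, s). X s \<omega>) \<in> borel_measurable (F u \<Otimes>\<^sub>M restrict_space borel {0..u})"
    using X u by (simp add: progressively_measurable_def)
  ultimately have "(\<lambda>\<omega>. (\<lambda>(\<omega>, s). X s \<omega>) (\<omega>, u)) \<in> borel_measurable (F u)"
    by (rule measurable_compose)
  then show "X u \<in> borel_measurable (F u)" by simp
qed

end

section \<open>The representation\<close>

text \<open>The scalar stopping problem for one component. The coupling of the components is hidden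
  in \<open>\<gamma>\<close>, the generator evaluated along the solution and treated as
  given.\<close>

lemma (in closed_martingale) reflected_equation_snell_envelope:
  fixes y S k :: "real \<Rightarrow> 'a \<Rightarrow> real" and \<xi> :: "'a \<Rightarrow> real" and \<gamma> :: "'a \<Rightarrow> real \<Rightarrow> real"
  assumes M_cont: "AE \<omega> in P. continuous_on {0..T} (\<lambda>t. M t \<omega>)"
    and y: "adapted F T y" "AE \<omega> in P. continuous_on {0..T} (\<lambda>t. y t \<omega>)"
    and y_int: "\<And>t. t \<in> {0..T} \<Longrightarrow> integrable P (y t)"
    and S: "progressively_measurable F T S" "AE \<omega> in P. continuous_on {0..T} (\<lambda>t. S t \<omega>)"
    and k: "AE \<omega> in P. continuous_on {0..T} (\<lambda>t. k t \<omega>)" "AE \<omega> in P. mono_on {0..T} (\<lambda>t. k t \<omega>)"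
    and \<xi>: "\<xi> \<in> borel_measurable P"
    and h: "h \<in> borel_measurable (prod_measure T)"
    and \<gamma>: "AE \<omega> in P. set_integrable lebesgue {0..T} (\<gamma> \<omega>) \<and>
      (\<forall>a b. 0 \<le> a \<and> b \<le> T \<longrightarrow>
        (LINT s:{a..b}|lebesgue. \<gamma> \<omega> s) = (LINT s|time_measure T. indicator {a..b} s * h (\<omega>, s)))"
    and eq: "\<And>t. t \<in> {0..T} \<Longrightarrow> AE \<omega> in P.
      y t \<omega> = \<xi> \<omega> + (LINT s:{t..T}|lebesgue. \<gamma> \<omega> s) + k T \<omega> - k t \<omega> - (M T \<omega> - M t \<omega>)"
    and obst: "\<And>t. t \<in> {0..T} \<Longrightarrow> AE \<omega> in P. S t \<omega> \<le> y t \<omega>"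
    and skorokhod: "AE \<omega> in P. (LINT t:{0..T}|stieltjes_measure T (\<lambda>t. k t \<omega>). y t \<omega> - S t \<omega>) = 0"
    and t: "t \<in> {0..T}"
  shows "is_esssup_family P
      {ereal_cond_exp P (F t) (\<lambda>\<omega>.
         (LINT s:{t..\<nu> \<omega>}|lebesgue. \<gamma> \<omega> s)
         + S (\<nu> \<omega>) \<omega> * indicator {\<omega>. \<nu> \<omega> < T} \<omega>
         + \<xi> \<omega> * indicator {\<omega>. \<nu> \<omega> = T} \<omega>)
       | \<nu>. \<nu> \<in> stopping_times_between P F t T}
      (\<lambda>\<omega>. ereal (y t \<omega>))"
proof -
  define R where "R \<nu> \<omega> = (LINT s:{t..\<nu> \<omega>}|lebesgue. \<gamma> \<omega> s)
         + S (\<nu> \<omega>) \<omega> * indicator {\<omega>. \<nu> \<omega> < T} \<omega> + \<xi> \<omega> * indicator {\<omega>. \<nu> \<omega> = T} \<omega>" for \<nu> \<omega>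
  \<comment> \<open>By the equation between \<open>t\<close> and \<open>\<nu>\<close>, this is the
    running integral plus \<open>y\<close> at \<open>\<nu>\<close> plus the increment of
    \<open>k\<close>. It exceeds the reward by that increment and by the gap between
    \<open>y\<close> and the payoff at \<open>\<nu>\<close>.\<close>
  define U where "U \<nu> \<omega> = y t \<omega> - M t \<omega> + M (\<nu> \<omega>) \<omega>" for \<nu> \<omega>
  have \<nu>_D: "stopping_time F \<nu>" "\<nu> \<in> borel_measurable P"
    "\<And>\<omega>. \<omega> \<in> space P \<Longrightarrow> t \<le> \<nu> \<omega> \<and> \<nu> \<omega> \<le> T" if "\<nu> \<in> stopping_times_between P F t T" for \<nu>
    using that measurable_stopping_time_P by (auto simp: stopping_times_between_def)
  have sf: "sigma_finite_subalgebra P (F t)" by (rule sigma_finite_subalgebra_F)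
  interpret Ft: sigma_finite_subalgebra P "F t" by (rule sf)

  have obst': "AE \<omega> in P. \<forall>s\<in>{0..T}. S s \<omega> \<le> y s \<omega>"
    by (rule AE_all_le[OF S(2) y(2) obst])
  have eq': "AE \<omega> in P. \<forall>s\<in>{0..T}.
      y s \<omega> = \<xi> \<omega> + (LINT u:{s..T}|lebesgue. \<gamma> \<omega> u) + k T \<omega> - k s \<omega> - (M T \<omega> - M s \<omega>)"
  proof (rule AE_all_eq[OF y(2) _ eq])
    show "AE \<omega> in P. continuous_on {0..T} (\<lambda>s.
        \<xi> \<omega> + (LINT u:{s..T}|lebesgue. \<gamma> \<omega> u) + k T \<omega> - k s \<omega> - (M T \<omega> - M s \<omega>))"
      using \<gamma> k(1) M_cont
      by eventually_elim (intro continuous_intros set_integral_lebesgue_tail(1); simp)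
  qed
  \<comment> \<open>The difference of the equations at \<open>t\<close> and \<open>r\<close>, on one
    null set for all \<open>r\<close>, so that \<open>r\<close> may be replaced by a stopping
    time.\<close>
  have path: "AE \<omega> in P. \<forall>r\<in>{t..T}.
      y t \<omega> = y r \<omega> + (LINT s:{t..r}|lebesgue. \<gamma> \<omega> s) + (k r \<omega> - k t \<omega>) - (M r \<omega> - M t \<omega>)"
    using eq' \<gamma>
  proof eventually_elim
    case (elim \<omega>)
    show ?case
    proof
      fix r assume r: "r \<in> {t..T}"
      have "r \<in> {0..T}" using r t by auto
      with elim(1) t have "y t \<omega> = \<xi> \<omega> + (LINT u:{t..T}|lebesgue. \<gamma> \<omega> u) + k T \<omega> - k t \<omega> - (M T \<omega> - M t \<omega>)"
        "y r \<omega> = \<xi> \<omega> + (LINT u:{r..T}|lebesgue. \<gamma> \<omega> u) + k T \<omega> - k r \<omega> - (M T \<omega> - M r \<omega>)"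
        by blast+
      moreover have "(LINT u:{t..T}|lebesgue. \<gamma> \<omega> u) = (LINT u:{t..r}|lebesgue. \<gamma> \<omega> u) + (LINT u:{r..T}|lebesgue. \<gamma> \<omega> u)"
        using elim(2) t r by (intro set_integral_lebesgue_tail(2)) auto
      ultimately show "y t \<omega> = y r \<omega> + (LINT s:{t..r}|lebesgue. \<gamma> \<omega> s) + (k r \<omega> - k t \<omega>) - (M r \<omega> - M t \<omega>)"
        by simp
    qed
  qed
  have terminal: "AE \<omega> in P. y T \<omega> = \<xi> \<omega>"
    using eq' by eventually_elim (use T in \<open>simp add: set_integral_lebesgue_point\<close>)

  have R_meas: "R \<nu> \<in> borel_measurable P" if \<nu>: "\<nu> \<in> stopping_times_between P F t T" for \<nu>
  proof -
    note \<nu>_D = \<nu>_D[OF \<nu>]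
    have "(\<lambda>\<omega>. LINT s:{t..\<nu> \<omega>}|lebesgue. \<gamma> \<omega> s) \<in> borel_measurable P"
    proof (rule borel_measurable_cong_AE[OF time_integral_stopped_measurable[OF h \<nu>_D(2)]])
      show "AE \<omega> in P. (LINT s|time_measure T. indicator {t..\<nu> \<omega>} s * h (\<omega>, s)) = (LINT s:{t..\<nu> \<omega>}|lebesgue. \<gamma> \<omega> s)"
        using \<gamma> AE_space
      proof eventually_elim
        case (elim \<omega>)
        then show ?case using t \<nu>_D(3)[OF elim(2)] by auto
      qed
    qed
    moreover have "(\<lambda>\<omega>. S (\<nu> \<omega>) \<omega>) \<in> borel_measurable P"
    proof (rule progressively_measurable_stopped[OF S(1) T \<nu>_D(2)])
      show "\<nu> \<omega> \<in> {0..T}" if "\<omega> \<in> space P" for \<omega>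
        using \<nu>_D(3)[OF that] t by simp
    qed
    moreover have "{\<omega>\<in>space P. \<nu> \<omega> < T} \<in> sets P" "{\<omega>\<in>space P. \<nu> \<omega> = T} \<in> sets P"
      using \<nu>_D(2) by measurable
    then have "(indicator {\<omega>. \<nu> \<omega> < T} :: 'a \<Rightarrow> real) \<in> borel_measurable P"
      "(indicator {\<omega>. \<nu> \<omega> = T} :: 'a \<Rightarrow> real) \<in> borel_measurable P"
      by (auto simp: borel_measurable_indicator_iff Int_def conj_commute)
    ultimately show ?thesis
      unfolding R_def[abs_def] using \<xi> by (intro borel_measurable_add borel_measurable_times)
  qed
  \<comment> \<open>\<open>y t - M t\<close> is known at time \<open>t\<close>, and optional
    stopping replaces \<open>M\<close> at \<open>\<nu>\<close> by \<open>M t\<close>; the answer is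
    the same for every \<open>\<nu>\<close>.\<close>
  have U: "integrable P (U \<nu>)" "AE \<omega> in P. ereal_cond_exp P (F t) (U \<nu>) \<omega> = ereal (y t \<omega>)"
    if \<nu>: "\<nu> \<in> stopping_times_between P F t T" for \<nu>
  proof -
    note os = optional_stopping[OF M_cont \<nu> t]
    have yM: "integrable P (\<lambda>\<omega>. y t \<omega> - M t \<omega>)"
      using y_int[OF t] M_integrable_all[OF t] by simp
    have yM': "(\<lambda>\<omega>. y t \<omega> - M t \<omega>) \<in> borel_measurable (F t)"
      using y(1) t by (intro borel_measurable_diff M_adapted) (auto simp: adapted_def)
    show int: "integrable P (U \<nu>)"
      unfolding U_def[abs_def] using yM os(1) by (rule Bochner_Integration.integrable_add)
    have "AE \<omega> in P. real_cond_exp P (F t) (U \<nu>) \<omega> = y t \<omega>"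
      using Ft.real_cond_exp_add[OF yM os(1)] os(2) Ft.real_cond_exp_F_meas[OF yM yM']
      unfolding U_def[abs_def] by eventually_elim simp
    then show "AE \<omega> in P. ereal_cond_exp P (F t) (U \<nu>) \<omega> = ereal (y t \<omega>)"
      using ereal_cond_exp_eq_real_cond_exp[OF sf int] by eventually_elim simp
  qed

  have upper: "AE \<omega> in P. ereal_cond_exp P (F t) (R \<nu>) \<omega> \<le> ereal (y t \<omega>)"
    if \<nu>: "\<nu> \<in> stopping_times_between P F t T" for \<nu>
  proof -
    have "AE \<omega> in P. R \<nu> \<omega> \<le> U \<nu> \<omega>"
      using path obst' terminal k(2) AE_space
    proof eventually_elim
      case (elim \<omega>)
      have r: "\<nu> \<omega> \<in> {t..T}" "\<nu> \<omega> \<in> {0..T}" using \<nu>_D(3)[OF \<nu> elim(5)] t by auto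
      have "k t \<omega> \<le> k (\<nu> \<omega>) \<omega>"
        using r t by (intro mono_onD[OF elim(4)]) auto
      \<comment> \<open>Before \<open>T\<close> this is the obstacle condition; at \<open>T\<close>
        the payoff is \<open>\<xi>\<close>, which equals \<open>y T\<close>.\<close>
      moreover have "S (\<nu> \<omega>) \<omega> * indicator {\<omega>. \<nu> \<omega> < T} \<omega> + \<xi> \<omega> * indicator {\<omega>. \<nu> \<omega> = T} \<omega> \<le> y (\<nu> \<omega>) \<omega>"
        using elim(2,3) r by (cases "\<nu> \<omega> = T") auto
      ultimately show ?case
        using bspec[OF elim(1) r(1)] by (simp add: R_def U_def)
    qed
    then have "AE \<omega> in P. ereal_cond_exp P (F t) (R \<nu>) \<omega> \<le> ereal_cond_exp P (F t) (U \<nu>) \<omega>"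
      using U(1)[OF \<nu>] by (intro ereal_cond_exp_mono[OF sf R_meas[OF \<nu>]]) auto
    then show ?thesis using U(2)[OF \<nu>] by eventually_elim simp
  qed

  define \<sigma> where "\<sigma> \<omega> = first_zero t T (\<lambda>s. y s \<omega> - S s \<omega>)" for \<omega>
  have YS_cont: "AE \<omega> in P. continuous_on {0..T} (\<lambda>s. y s \<omega> - S s \<omega>)"
    using y(2) S(2) by eventually_elim (rule continuous_on_diff)
  have \<sigma>: "\<sigma> \<in> stopping_times_between P F t T"
    unfolding \<sigma>_def
  proof (rule first_zero_stopping_time[OF _ YS_cont _ t])
    show "adapted F T (\<lambda>s \<omega>. y s \<omega> - S s \<omega>)"
      using y(1) progressively_measurable_adapted[OF S(1)] unfolding adapted_def
      by (intro ballI borel_measurable_diff) auto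
    show "AE \<omega> in P. \<forall>s\<in>{0..T}. 0 \<le> y s \<omega> - S s \<omega>"
      using obst' by eventually_elim simp
  qed
  have lower: "AE \<omega> in P. ereal (y t \<omega>) \<le> ereal_cond_exp P (F t) (R \<sigma>) \<omega>"
  proof -
    have "AE \<omega> in P. U \<sigma> \<omega> \<le> R \<sigma> \<omega>"
      using path obst' terminal k YS_cont skorokhod
    proof eventually_elim
      case (elim \<omega>)
      have tT: "t \<le> T" using t by simp
      have r: "t \<le> \<sigma> \<omega>" "\<sigma> \<omega> \<le> T" using first_zero_bounds[OF tT] by (auto simp: \<sigma>_def)
      have "k (\<sigma> \<omega>) \<omega> = k t \<omega>"
      proof (rule skorokhod_flat[OF T elim(4,5,6) _ elim(7)])
        show "0 \<le> y s \<omega> - S s \<omega>" if "s \<in> {0..T}" for s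
          using elim(2) that by simp
        show "0 < y s \<omega> - S s \<omega>" if s: "t \<le> s" "s < \<sigma> \<omega>" for s
        proof -
          have "y s \<omega> - S s \<omega> \<noteq> 0"
            using first_zero_lower[of s t T "\<lambda>s. y s \<omega> - S s \<omega>"] s r by (auto simp: \<sigma>_def)
          moreover have "S s \<omega> \<le> y s \<omega>" using elim(2) s r t by auto
          ultimately show ?thesis by simp
        qed
      qed (use r t in auto)
      \<comment> \<open>Stopping before \<open>T\<close> means contact, where \<open>y\<close> and
        \<open>S\<close> agree. The value \<open>T\<close> covers contact at \<open>T\<close> as
        well as no contact; either way \<open>\<xi>\<close> is paid.\<close>
      moreover have "S (\<sigma> \<omega>) \<omega> * indicator {\<omega>. \<sigma> \<omega> < T} \<omega> + \<xi> \<omega> * indicator {\<omega>. \<sigma> \<omega> = T} \<omega> = y (\<sigma> \<omega>) \<omega>"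
      proof (cases "\<sigma> \<omega> = T")
        case False
        then have "y (\<sigma> \<omega>) \<omega> - S (\<sigma> \<omega>) \<omega> = 0"
          unfolding \<sigma>_def using r t by (intro first_zero_zero continuous_on_subset[OF elim(6)]) (auto simp: \<sigma>_def)
        then show ?thesis using False r by simp
      qed (use elim(3) in simp)
      moreover have "\<sigma> \<omega> \<in> {t..T}" using r by simp
      note bspec[OF elim(1) this]
      ultimately show ?case
        by (simp add: R_def U_def)
    qed
    then have "AE \<omega> in P. ereal_cond_exp P (F t) (U \<sigma>) \<omega> \<le> ereal_cond_exp P (F t) (R \<sigma>) \<omega>"
      using U(1)[OF \<sigma>] by (intro ereal_cond_exp_mono[OF sf _ R_meas[OF \<sigma>]]) auto
    then show ?thesis using U(2)[OF \<sigma>] by eventually_elim simp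
  qed

  \<comment> \<open>The supremum is attained: the member of the family given by
    \<open>\<sigma>\<close> already reaches \<open>y t\<close>, so every other upper bound lies
    above it.\<close>
  have "is_esssup_family P {ereal_cond_exp P (F t) (R \<nu>) |\<nu>. \<nu> \<in> stopping_times_between P F t T}
      (\<lambda>\<omega>. ereal (y t \<omega>))"
    unfolding is_esssup_family_def
  proof (intro conjI ballI impI)
    show "(\<lambda>\<omega>. ereal (y t \<omega>)) \<in> borel_measurable P"
      using y_int[OF t] by auto
  next
    fix \<phi> assume "\<phi> \<in> {ereal_cond_exp P (F t) (R \<nu>) |\<nu>. \<nu> \<in> stopping_times_between P F t T}"
    then obtain \<nu> where "\<nu> \<in> stopping_times_between P F t T" "\<phi> = ereal_cond_exp P (F t) (R \<nu>)" by blast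
    then show "AE \<omega> in P. \<phi> \<omega> \<le> ereal (y t \<omega>)" using upper by simp
  next
    fix X' :: "'a \<Rightarrow> ereal"
    assume "\<forall>\<phi>\<in>{ereal_cond_exp P (F t) (R \<nu>) |\<nu>. \<nu> \<in> stopping_times_between P F t T}. AE \<omega> in P. \<phi> \<omega> \<le> X' \<omega>"
    then have "AE \<omega> in P. ereal_cond_exp P (F t) (R \<sigma>) \<omega> \<le> X' \<omega>" using \<sigma> by blast
    with lower show "AE \<omega> in P. ereal (y t \<omega>) \<le> X' \<omega>"
      by eventually_elim (rule order_trans)
  qed
  then show ?thesis unfolding R_def[abs_def] .
qed

theorem theorem2p2:
  fixes M P :: "'a measure" and F :: "real \<Rightarrow> 'a measure"
    and T C :: real
    and W :: "real \<Rightarrow> 'a \<Rightarrow> real ^ 'd"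
    and f :: "'n::finite \<Rightarrow> 'a \<Rightarrow> real \<Rightarrow> real ^ 'n \<Rightarrow> real ^ 'd \<Rightarrow> real"
    and \<xi> :: "'a \<Rightarrow> real ^ 'n"
    and S Y ZW K :: "real \<Rightarrow> 'a \<Rightarrow> real ^ 'n"
    and Z :: "real \<Rightarrow> 'a \<Rightarrow> real ^ 'd ^ 'n"
  assumes "T > 0"
    and "brownian_motion M T W"
    and "P = completion M"
    and "F = augmented_filtration M T W"
    and "C > 0"
    and "assumption_A1 P F T C f"
    and "assumption_A2 P T f"
    and "assumption_A3 P F T C S"
    and "assumption_A4 P F T C \<xi>"
    and "reflected_bsde_solution P F T W f \<xi> S Y Z ZW K"
    and "Y \<in> Sinf_space P F T"
    and "ZW \<in> BMO P F T"
    and "\<forall>p\<ge>2. K \<in> Sp_space P F T p"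
  shows "\<forall>t\<in>{0..T}. \<forall>i.
    is_esssup_family P
      {ereal_cond_exp P (F t) (\<lambda>\<omega>.
         (LINT s:{t..\<nu> \<omega>}|lebesgue. f i \<omega> s (Y s \<omega>) (Z s \<omega> $ i))
         + S (\<nu> \<omega>) \<omega> $ i * indicator {\<omega>. \<nu> \<omega> < T} \<omega>
         + \<xi> \<omega> $ i * indicator {\<omega>. \<nu> \<omega> = T} \<omega>)
       | \<nu>. \<nu> \<in> stopping_times_between P F t T}
      (\<lambda>\<omega>. ereal (Y t \<omega> $ i))"
proof (intro ballI allI)
  fix t i assume t: "t \<in> {0..T}"
  have T: "0 \<le> T" using assms(1) by simp
  interpret complete_filtration P F
    unfolding assms(3,4) by (rule complete_filtration_augmented) fact
  have comp: "(\<lambda>\<omega>. X \<omega> $ i) \<in> borel_measurable N" if "X \<in> borel_measurable N"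
    for X :: "'b \<Rightarrow> real ^ 'n" and N
    using that by (intro measurable_compose[OF that] borel_measurable_continuous_onI continuous_intros)
  have cont: "AE \<omega> in P. continuous_on {0..T} (\<lambda>t. X t \<omega> $ i)" if "continuous_process P T X"
    for X :: "real \<Rightarrow> 'a \<Rightarrow> real ^ 'n"
    using that unfolding continuous_process_def by eventually_elim (intro continuous_intros)
  note sol = assms(10)[unfolded reflected_bsde_solution_def]
  have ito: "is_ito_integral P F T W (\<lambda>t \<omega>. Z t \<omega> $ i) (\<lambda>t \<omega>. ZW t \<omega> $ i)" using sol by blast
  have mart: "martingale P F T ZW" using assms(12) by (simp add: BMO_def)
  \<comment> \<open>The martingale property contained in BMO is read between \<open>s\<close> and
    \<open>T\<close>, for the component \<open>i\<close>.\<close>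
  interpret closed_martingale P F T "\<lambda>t \<omega>. ZW t \<omega> $ i"
  proof
    show "(\<lambda>\<omega>. ZW s \<omega> $ i) \<in> borel_measurable (F s)" if "s \<in> {0..T}" for s
      using mart that by (intro comp) (auto simp: martingale_def adapted_def)
    show "integrable P (\<lambda>\<omega>. ZW T \<omega> $ i)"
      using mart T by (intro integrable_bounded_linear[OF bounded_linear_vec_nth]) (auto simp: martingale_def)
    show "AE \<omega> in P. ZW s \<omega> $ i = real_cond_exp P (F s) (\<lambda>\<omega>. ZW T \<omega> $ i) \<omega>" if "s \<in> {0..T}" for s
      using mart that by (auto simp: martingale_def)
  qed (rule T)
  obtain h where h: "h \<in> borel_measurable (prod_measure T)"
    "AE \<omega> in P. set_integrable lebesgue {0..T} (\<lambda>s. f i \<omega> s (Y s \<omega>) (Z s \<omega> $ i)) \<and>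
      (\<forall>a b. 0 \<le> a \<and> b \<le> T \<longrightarrow> (LINT s:{a..b}|lebesgue. f i \<omega> s (Y s \<omega>) (Z s \<omega> $ i)) =
         (LINT s|time_measure T. indicator {a..b} s * h (\<omega>, s)))"
    using generator_time_integrable[where i=i, OF assms(6) T less_imp_le[OF assms(5)] assms(11) ito] by blast
  obtain B where B: "AE \<omega> in P. \<forall>t\<in>{0..T}. norm (Y t \<omega>) \<le> B"
    using assms(11) Sinf_norm_bounded[of P T Y] by (auto simp: Sinf_space_def)
  have Y: "adapted F T (\<lambda>t \<omega>. Y t \<omega> $ i)"
    using sol comp by (auto simp: adapted_def)
  show "is_esssup_family P
      {ereal_cond_exp P (F t) (\<lambda>\<omega>.
         (LINT s:{t..\<nu> \<omega>}|lebesgue. f i \<omega> s (Y s \<omega>) (Z s \<omega> $ i))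
         + S (\<nu> \<omega>) \<omega> $ i * indicator {\<omega>. \<nu> \<omega> < T} \<omega>
         + \<xi> \<omega> $ i * indicator {\<omega>. \<nu> \<omega> = T} \<omega>)
       | \<nu>. \<nu> \<in> stopping_times_between P F t T}
      (\<lambda>\<omega>. ereal (Y t \<omega> $ i))"
  proof (rule reflected_equation_snell_envelope[OF _ Y _ _ _ _ _ _ _ h])
    show "AE \<omega> in P. continuous_on {0..T} (\<lambda>t. ZW t \<omega> $ i)"
      using ito by (simp add: is_ito_integral_def continuous_process_def)
    show "AE \<omega> in P. continuous_on {0..T} (\<lambda>t. Y t \<omega> $ i)" "AE \<omega> in P. continuous_on {0..T} (\<lambda>t. K t \<omega> $ i)"
      using sol cont by auto
    show "AE \<omega> in P. continuous_on {0..T} (\<lambda>t. S t \<omega> $ i)"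
      using assms(8) by (intro cont) (simp add: assumption_A3_def)
    show "integrable P (\<lambda>\<omega>. Y s \<omega> $ i)" if s: "s \<in> {0..T}" for s
    proof (rule integrable_const_bound)
      show "AE \<omega> in P. norm (Y s \<omega> $ i) \<le> B"
        using B
      proof eventually_elim
        case (elim \<omega>)
        show ?case using order_trans[OF component_le_norm_cart bspec[OF elim s]] by simp
      qed
      show "(\<lambda>\<omega>. Y s \<omega> $ i) \<in> borel_measurable P"
        using Y s by (intro measurable_F_P[of _ s]) (auto simp: adapted_def)
    qed
    show "progressively_measurable F T (\<lambda>t \<omega>. S t \<omega> $ i)"
      using assms(8) unfolding assumption_A3_def progressively_measurable_def case_prod_beta'
      by (intro ballI comp) simp
    show "AE \<omega> in P. mono_on {0..T} (\<lambda>t. K t \<omega> $ i)" using sol by blast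
    show "(\<lambda>\<omega>. \<xi> \<omega> $ i) \<in> borel_measurable P"
      using assms(9) measurable_F_P by (intro comp) (auto simp: assumption_A4_def)
    show "AE \<omega> in P. Y s \<omega> $ i = \<xi> \<omega> $ i + (LINT s:{s..T}|lebesgue. f i \<omega> s (Y s \<omega>) (Z s \<omega> $ i))
          + K T \<omega> $ i - K s \<omega> $ i - (ZW T \<omega> $ i - ZW s \<omega> $ i)" if "s \<in> {0..T}" for s
      using sol that by blast
    show "AE \<omega> in P. S s \<omega> $ i \<le> Y s \<omega> $ i" if "s \<in> {0..T}" for s
      using sol that by blast
    show "AE \<omega> in P. (LINT t:{0..T}|stieltjes_measure T (\<lambda>t. K t \<omega> $ i). Y t \<omega> $ i - S t \<omega> $ i) = 0"
      using sol by blast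
  qed (rule t)
qed

end
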